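(* Let $L_{\mathrm{EQ}}(n)=\{x\#^ny: x,y\in\{0,1\}^n,\ x=y\}$ over $\Sigma=\{0,1,\#\}$. Then $\mathrm{TS}_{2DFA}(L_{\mathrm{EQ}}(n))=\Theta(n^2)$ and $\mathrm{TS}_{2PFA}(L_{\mathrm{EQ}}(n))=\Theta(n\log n)$.
   Context: Two-way automata read $\vdash w\$$ with a head moving left/stay/right per step. A 2DFA has deterministic transitions $S\times(\Sigma\cup\{\vdash,\$\})\to S\times\{-1,0,1\}$ and halts upon entering an accepting or rejecting state; a 2PFA has probabilistic transitions and recognizes $L$ with error $\epsilon$ if members are accepted with probability $\ge1-\epsilon$ and non-members with probability $\le\epsilon$. $\mathrm{time}(M)$ is the maximal number of steps before halting, $\mathrm{space}(M)=\log_2(\#\text{states})$, $\mathrm{TS}(M)=\mathrm{time}(M)\cdot\mathrm{space}(M)$. $\mathrm{TS}_{2DFA}(L)$ is the infimum of $\mathrm{TS}(M)$ over 2DFAs recognizing $L$; $\mathrm{TS}_{2PFA}(L)$ is the infimum over 2PFAs recognizing $L$ with bounded error (at most $1/3$). *)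

theory Defs
  imports "HOL-Probability.Probability" "HOL-Library.Landau_Symbols"
begin

datatype 'a tape_sym = LEnd | Sym 'a | REnd

text \<open>Cell \<open>0\<close> holds the left endmarker, cells \<open>1\<close> to \<open>length w\<close> hold the input word, and cell
  \<open>length w + 1\<close> holds the right endmarker. Later cells are never reached by a well-formed
  automaton.\<close>

definition tape :: "'a list \<Rightarrow> nat \<Rightarrow> 'a tape_sym" where
  "tape w i = (if i = 0 then LEnd else if i \<le> length w then Sym (w ! (i - 1)) else REnd)"

text \<open>A configuration is a state together with a head position.\<close>

type_synonym 's config = "'s \<times> nat"

record 's control =
  states :: "'s set"
  start :: 's
  acc :: "'s set"
  rej :: "'s set"

definition wf_control :: "('s, 'z) control_scheme \<Rightarrow> bool" where
  "wf_control M \<longleftrightarrow> finite (states M) \<and> start M \<in> states M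
     \<and> acc M \<subseteq> states M \<and> rej M \<subseteq> states M \<and> acc M \<inter> rej M = {}"

definition halting :: "('s, 'z) control_scheme \<Rightarrow> 's config \<Rightarrow> bool" where
  "halting M c \<longleftrightarrow> fst c \<in> acc M \<union> rej M"

definition accepting :: "('s, 'z) control_scheme \<Rightarrow> 's config \<Rightarrow> bool" where
  "accepting M c \<longleftrightarrow> fst c \<in> acc M"

definition space_of :: "('s, 'z) control_scheme \<Rightarrow> real" where
  "space_of M = log 2 (real (card (states M)))"

text \<open>The moves allowed on reading a given symbol; the head may not leave the part of the tape
  delimited by the endmarkers.\<close>

definition legal_moves :: "('s, 'z) control_scheme \<Rightarrow> 'a tape_sym \<Rightarrow> ('s \<times> int) set" where
  "legal_moves M a = {(s, d). s \<in> states M \<and> d \<in> {-1, 0, 1}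
     \<and> (a = LEnd \<longrightarrow> d \<noteq> -1) \<and> (a = REnd \<longrightarrow> d \<noteq> 1)}"

definition apply_move :: "nat \<Rightarrow> 's \<times> int \<Rightarrow> 's config" where
  "apply_move i m = (fst m, nat (int i + snd m))"


subsection \<open>Deterministic automata\<close>

record ('s, 'a) dfa2 = "'s control" +
  dtrans :: "'s \<Rightarrow> 'a tape_sym \<Rightarrow> 's \<times> int"

definition wf_dfa2 :: "('s, 'a) dfa2 \<Rightarrow> bool" where
  "wf_dfa2 M \<longleftrightarrow> wf_control M \<and> (\<forall>s\<in>states M. \<forall>a. dtrans M s a \<in> legal_moves M a)"

text \<open>Halting configurations are made absorbing, here and for probabilistic automata.\<close>

definition dfa2_step :: "('s, 'a) dfa2 \<Rightarrow> 'a list \<Rightarrow> 's config \<Rightarrow> 's config" where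
  "dfa2_step M w c = (if halting M c then c
     else apply_move (snd c) (dtrans M (fst c) (tape w (snd c))))"

definition dfa2_run :: "('s, 'a) dfa2 \<Rightarrow> 'a list \<Rightarrow> nat \<Rightarrow> 's config" where
  "dfa2_run M w t = (dfa2_step M w ^^ t) (start M, 0)"

definition dfa2_accepts :: "('s, 'a) dfa2 \<Rightarrow> 'a list \<Rightarrow> bool" where
  "dfa2_accepts M w \<longleftrightarrow> (\<exists>t. accepting M (dfa2_run M w t))"

definition dfa2_recognizes :: "('s, 'a) dfa2 \<Rightarrow> 'a list set \<Rightarrow> bool" where
  "dfa2_recognizes M L \<longleftrightarrow> wf_dfa2 M \<and> (\<forall>w. dfa2_accepts M w \<longleftrightarrow> w \<in> L)"

text \<open>The value is \<open>\<infinity>\<close> if the automaton does not halt.\<close>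

definition dfa2_steps :: "('s, 'a) dfa2 \<Rightarrow> 'a list \<Rightarrow> enat" where
  "dfa2_steps M w = (INF t\<in>{t. halting M (dfa2_run M w t)}. enat t)"

definition dfa2_time :: "('s, 'a) dfa2 \<Rightarrow> enat" where
  "dfa2_time M = (SUP w. dfa2_steps M w)"

text \<open>The convention \<open>\<infinity> * 0 = 0\<close> matters only for one-state automata. These recognize at most the
  empty and the full language, for which the infimum below is \<open>0\<close> in any case, because of the
  one-state automata that halt at once.\<close>

definition dfa2_TS :: "('s, 'a) dfa2 \<Rightarrow> ennreal" where
  "dfa2_TS M = ennreal_of_enat (dfa2_time M) * ennreal (space_of M)"

text \<open>State sets are finite, so up to renaming of states it suffices to consider states that are
  natural numbers.\<close>

definition TS_2DFA :: "'a list set \<Rightarrow> ennreal" where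
  "TS_2DFA L = (INF M\<in>{M :: (nat, 'a) dfa2. dfa2_recognizes M L}. dfa2_TS M)"


subsection \<open>Probabilistic automata\<close>

record ('s, 'a) pfa2 = "'s control" +
  ptrans :: "'s \<Rightarrow> 'a tape_sym \<Rightarrow> ('s \<times> int) pmf"

definition wf_pfa2 :: "('s, 'a) pfa2 \<Rightarrow> bool" where
  "wf_pfa2 M \<longleftrightarrow> wf_control M \<and> (\<forall>s\<in>states M. \<forall>a. set_pmf (ptrans M s a) \<subseteq> legal_moves M a)"

definition pfa2_step :: "('s, 'a) pfa2 \<Rightarrow> 'a list \<Rightarrow> 's config \<Rightarrow> 's config pmf" where
  "pfa2_step M w c = (if halting M c then return_pmf c
     else map_pmf (apply_move (snd c)) (ptrans M (fst c) (tape w (snd c))))"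

primrec pfa2_run :: "('s, 'a) pfa2 \<Rightarrow> 'a list \<Rightarrow> nat \<Rightarrow> 's config pmf" where
  "pfa2_run M w 0 = return_pmf (start M, 0)"
| "pfa2_run M w (Suc t) = bind_pmf (pfa2_run M w t) (pfa2_step M w)"

text \<open>The probability of having accepted within \<open>t\<close> steps is nondecreasing in \<open>t\<close>, so the supremum
  is the probability of ever accepting.\<close>

definition pfa2_accept_prob :: "('s, 'a) pfa2 \<Rightarrow> 'a list \<Rightarrow> real" where
  "pfa2_accept_prob M w = (SUP t. measure_pmf.prob (pfa2_run M w t) {c. accepting M c})"

definition pfa2_recognizes :: "real \<Rightarrow> ('s, 'a) pfa2 \<Rightarrow> 'a list set \<Rightarrow> bool" where
  "pfa2_recognizes \<epsilon> M L \<longleftrightarrow> wf_pfa2 M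
     \<and> (\<forall>w\<in>L. pfa2_accept_prob M w \<ge> 1 - \<epsilon>)
     \<and> (\<forall>w. w \<notin> L \<longrightarrow> pfa2_accept_prob M w \<le> \<epsilon>)"

text \<open>Since halting configurations are absorbing, this is the maximal number of steps before
  halting over all computation paths of positive probability, and \<open>\<infinity>\<close> if these path lengths are
  unbounded.\<close>

definition pfa2_steps :: "('s, 'a) pfa2 \<Rightarrow> 'a list \<Rightarrow> enat" where
  "pfa2_steps M w = (INF t\<in>{t. \<forall>c\<in>set_pmf (pfa2_run M w t). halting M c}. enat t)"

definition pfa2_time :: "('s, 'a) pfa2 \<Rightarrow> enat" where
  "pfa2_time M = (SUP w. pfa2_steps M w)"

definition pfa2_TS :: "('s, 'a) pfa2 \<Rightarrow> ennreal" where
  "pfa2_TS M = ennreal_of_enat (pfa2_time M) * ennreal (space_of M)"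

definition TS_2PFA :: "'a list set \<Rightarrow> ennreal" where
  "TS_2PFA L = (INF M\<in>{M :: (nat, 'a) pfa2. \<exists>\<epsilon>. 0 \<le> \<epsilon> \<and> \<epsilon> \<le> 1/3 \<and> pfa2_recognizes \<epsilon> M L}. pfa2_TS M)"


subsection \<open>The equality language\<close>

datatype letter = Zero | One | Hash

definition L_EQ :: "nat \<Rightarrow> letter list set" where
  "L_EQ n = {x @ replicate n Hash @ y | x y.
     length x = n \<and> length y = n \<and> set x \<subseteq> {Zero, One} \<and> set y \<subseteq> {Zero, One} \<and> x = y}"

text \<open>In bounds on \<open>enn2real (TS_2DFA (L_EQ n))\<close> and \<open>enn2real (TS_2PFA (L_EQ n))\<close>, note that
  \<open>enn2real \<infinity> = 0\<close>: an eventually positive lower bound implies eventual finiteness, whereas an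
  upper bound alone does not.\<close>

end

theory Submission
  imports Defs "HOL-Number_Theory.Cong"
begin

text \<open>For the lower bounds, cut the computation on \<open>x #\<^sup>n y\<close> whenever the head has crossed the block of
  \<open>n\<close> separators. A crossing takes more than \<open>n\<close> steps, so a machine with \<open>S\<close> states and time \<open>T\<close> has
  at most \<open>N = S ^ (T div (n + 1))\<close> sequences of crossing states. Hence the acceptance probability is
  a sum of \<open>N\<close> products of a function of \<open>x\<close> and a function of \<open>y\<close>, all with values in \<open>[0, 1]\<close>. In
  the deterministic case the diagonal is a fooling set, so \<open>2 ^ n \<le> N\<close>. In the bounded-error case,
  rounding the functions of \<open>x\<close> gives \<open>2 ^ n \<le> (4 * N + 1) ^ N\<close>. In both cases \<open>T * log S \<ge> n * log N\<close>.

  For the upper bounds, a one-pass automaton compares the sums \<open>\<Sum>i. x\<^sub>i * c i\<close> and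
  \<open>\<Sum>i. y\<^sub>i * c i\<close> modulo \<open>q\<close>. Deterministically, take \<open>c i = 2 ^ i\<close> and \<open>q = 2 ^ n\<close>. With
  randomness, take \<open>q = 64\<close> and choose \<open>c\<close> uniformly from a fixed list of \<open>2 * n\<close> coefficient
  vectors, which exists by averaging and on which any two distinct words collide for at most a third
  of the vectors; since the automaton may depend on \<open>n\<close>, no explicit construction is needed.\<close>

section \<open>Crossing the separator\<close>

primrec iter_pmf :: "('c \<Rightarrow> 'c pmf) \<Rightarrow> nat \<Rightarrow> 'c \<Rightarrow> 'c pmf" where
  "iter_pmf K 0 c = return_pmf c"
| "iter_pmf K (Suc t) c = bind_pmf (K c) (iter_pmf K t)"

lemma iter_pmf_0_eq: "iter_pmf K 0 = return_pmf"
  by (simp add: fun_eq_iff)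

lemma iter_pmf_Suc_right: "iter_pmf K (Suc t) c = bind_pmf (iter_pmf K t c) K"
proof (induction t arbitrary: c)
  case 0
  then show ?case by (simp add: iter_pmf_0_eq bind_return_pmf bind_return_pmf')
next
  case (Suc t)
  have "iter_pmf K (Suc (Suc t)) c = bind_pmf (K c) (\<lambda>c'. bind_pmf (iter_pmf K t c') K)"
    by (subst iter_pmf.simps(2)) (use Suc in \<open>simp cong: bind_pmf_cong\<close>)
  then show ?case by (simp add: bind_assoc_pmf)
qed

lemma iter_pmf_invariant:
  assumes "c' \<in> set_pmf (iter_pmf K t c)" "P c"
    and "\<And>c c'. P c \<Longrightarrow> c' \<in> set_pmf (K c) \<Longrightarrow> P c'"
  shows "P c'"
  using assms(1,2) by (induction t arbitrary: c) (auto dest: assms(3))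

text \<open>\<open>pfa2_run\<close> unfolds the last step, \<open>iter_pmf\<close> the first. The
  latter form lets the inductions below generalise over the starting configuration.\<close>

lemma pfa2_run_eq_iter: "pfa2_run M w t = iter_pmf (pfa2_step M w) t (start M, 0)"
  by (induction t) (simp_all add: iter_pmf_Suc_right del: iter_pmf.simps(2))

text \<open>Making \<open>Z\<close> absorbing yields the chain stopped on entering \<open>Z\<close>
  while the number of iterations stays a fixed number.\<close>

definition freeze :: "'c set \<Rightarrow> ('c \<Rightarrow> 'c pmf) \<Rightarrow> 'c \<Rightarrow> 'c pmf" where
  "freeze Z K c = (if c \<in> Z then return_pmf c else K c)"

lemma iter_pmf_return:
  assumes "K c = return_pmf c"
  shows "iter_pmf K t c = return_pmf c"
  using assms by (induction t) (auto simp: bind_return_pmf)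

definition halts_within :: "('s, 'a) pfa2 \<Rightarrow> 'a list \<Rightarrow> nat \<Rightarrow> 's config \<Rightarrow> bool" where
  "halts_within M w u c \<longleftrightarrow> (\<forall>c'\<in>set_pmf (iter_pmf (pfa2_step M w) u c). halting M c')"

lemma halts_within_0 [simp]: "halts_within M w 0 c \<longleftrightarrow> halting M c"
  by (simp add: halts_within_def)

lemma pfa2_step_halting: "halting M c \<Longrightarrow> pfa2_step M w c = return_pmf c"
  by (simp add: pfa2_step_def)

lemma halts_within_step:
  assumes "halts_within M w (Suc u) c" "c' \<in> set_pmf (pfa2_step M w c)"
  shows "halts_within M w u c'"
  using assms by (auto simp: halts_within_def)

lemma iter_pmf_halted:
  assumes "halts_within M w u c" "u \<le> t"
  shows "iter_pmf (pfa2_step M w) t c = iter_pmf (pfa2_step M w) u c"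
  using assms(2)
proof (induction t rule: dec_induct)
  case (step t)
  have "iter_pmf (pfa2_step M w) (Suc t) c = bind_pmf (iter_pmf (pfa2_step M w) u c) return_pmf"
    unfolding iter_pmf_Suc_right step.IH
    using assms(1) by (intro bind_pmf_cong) (auto simp: halts_within_def pfa2_step_halting)
  then show ?case by (simp add: bind_return_pmf')
qed simp

lemma halts_within_mono: "halts_within M w u c \<Longrightarrow> u \<le> t \<Longrightarrow> halts_within M w t c"
  using iter_pmf_halted[of M w u c t] by (simp add: halts_within_def)

definition outcome :: "('s, 'a) pfa2 \<Rightarrow> 'a list \<Rightarrow> nat \<Rightarrow> 's config \<Rightarrow> 's pmf" where
  "outcome M w T c = map_pmf fst (iter_pmf (pfa2_step M w) T c)"

lemma outcome_halting: "halting M c \<Longrightarrow> outcome M w T c = return_pmf (fst c)"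
  by (simp add: outcome_def iter_pmf_return pfa2_step_halting)

lemma outcome_step:
  assumes "halts_within M w T c"
  shows "bind_pmf (pfa2_step M w c) (outcome M w T) = outcome M w T c"
proof -
  have "bind_pmf (pfa2_step M w c) (outcome M w T)
      = map_pmf fst (iter_pmf (pfa2_step M w) (Suc T) c)"
    by (simp add: outcome_def[abs_def] map_bind_pmf)
  then show ?thesis
    using iter_pmf_halted[OF assms, of "Suc T"] by (simp add: outcome_def)
qed

text \<open>A strong Markov property: stop at \<open>Z\<close>, then restart with the full horizon
  \<open>T\<close>. The total number of steps may exceed \<open>T\<close>, but the run has halted by
  then, so the surplus changes nothing.\<close>

lemma outcome_freeze:
  assumes "halts_within M w T c"
  shows "bind_pmf (iter_pmf (freeze Z (pfa2_step M w)) t c) (outcome M w T) = outcome M w T c"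
  using assms
proof (induction t arbitrary: c)
  case 0
  then show ?case by (simp add: bind_return_pmf)
next
  case (Suc t)
  show ?case
  proof (cases "c \<in> Z")
    case True
    then show ?thesis
      by (subst iter_pmf_return) (auto simp: freeze_def bind_return_pmf)
  next
    case False
    \<comment> \<open>The deadline is first relaxed to \<open>Suc T\<close>, so that after one step
      it is \<open>T\<close> again and the induction hypothesis applies.\<close>
    have "halts_within M w T c'" if "c' \<in> set_pmf (pfa2_step M w c)" for c'
      using halts_within_step[OF halts_within_mono[OF Suc.prems le_SucI[OF order_refl]] that] .
    then have "bind_pmf (pfa2_step M w c)
          (\<lambda>c'. bind_pmf (iter_pmf (freeze Z (pfa2_step M w)) t c') (outcome M w T))
        = bind_pmf (pfa2_step M w c) (outcome M w T)"
      by (intro bind_pmf_cong refl Suc.IH)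
    moreover have "freeze Z (pfa2_step M w) c = pfa2_step M w c" using False by (simp add: freeze_def)
    ultimately show ?thesis
      using outcome_step[OF Suc.prems] by (simp add: bind_assoc_pmf)
  qed
qed

lemma pfa2_step_support:
  assumes "wf_pfa2 M" "fst c \<in> states M" "c' \<in> set_pmf (pfa2_step M w c)"
  shows "fst c' \<in> states M" "snd c' \<le> Suc (snd c)" "snd c \<le> Suc (snd c')"
proof -
  have "set_pmf (ptrans M (fst c) a) \<subseteq> legal_moves M a" for a
    using assms(1,2) by (auto simp: wf_pfa2_def)
  then have "c' = c \<or> (\<exists>s d. c' = apply_move (snd c) (s, d) \<and> s \<in> states M \<and> d \<in> {-1, 0, 1})"
    using assms(3) by (fastforce simp: pfa2_step_def legal_moves_def split: if_splits)
  then show "fst c' \<in> states M" "snd c' \<le> Suc (snd c)" "snd c \<le> Suc (snd c')"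
    using assms(2) by (auto simp: apply_move_def)
qed

text \<open>A stopped path has either halted or entered \<open>Z\<close>. In the second case
  \<open>d\<close> counts the steps actually taken: it is deducted from the deadline
  \<open>u\<close>, and it bounds the displacement because the head moves at most one cell per
  step.\<close>

lemma frozen_support:
  assumes wf: "wf_pfa2 M"
    and "c' \<in> set_pmf (iter_pmf (freeze Z (pfa2_step M w)) t c)"
    and "fst c \<in> states M" "halts_within M w u c" "u \<le> t"
  shows "halting M c' \<or> c' \<in> Z \<and> (\<exists>d\<le>u. halts_within M w (u - d) c'
           \<and> snd c' \<le> snd c + d \<and> snd c \<le> snd c' + d)"
  using assms(2-)
proof (induction t arbitrary: u c)
  case 0
  then show ?case by simp
next
  case (Suc t)
  show ?case
  proof (cases "c \<in> Z \<or> halting M c")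
    case True
    then have "iter_pmf (freeze Z (pfa2_step M w)) (Suc t) c = return_pmf c"
      by (intro iter_pmf_return) (auto simp: freeze_def pfa2_step_halting)
    then have "c' = c" using Suc.prems(1) by simp
    then show ?thesis using True Suc.prems(3) by (auto intro: exI[of _ 0])
  next
    case False
    then obtain u' where u: "u = Suc u'" using Suc.prems(3) by (cases u) auto
    have "freeze Z (pfa2_step M w) c = pfa2_step M w c" using False by (simp add: freeze_def)
    with Suc.prems(1) obtain c1 where c1: "c1 \<in> set_pmf (pfa2_step M w c)"
      "c' \<in> set_pmf (iter_pmf (freeze Z (pfa2_step M w)) t c1)"
      unfolding iter_pmf.simps set_bind_pmf by auto
    note c1_near = pfa2_step_support[OF wf Suc.prems(2) c1(1)]
    have "halts_within M w u' c1" using Suc.prems(3) c1(1) unfolding u by (rule halts_within_step)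
    from Suc.IH[OF c1(2) c1_near(1) this] Suc.prems(4) u
    consider "halting M c'" | d where "c' \<in> Z" "d \<le> u'" "halts_within M w (u' - d) c'"
      "snd c' \<le> snd c1 + d" "snd c1 \<le> snd c' + d" by auto
    then show ?thesis
    proof cases
      case 2
      then show ?thesis using u c1_near by (auto intro!: exI[of _ "Suc d"])
    qed simp
  qed
qed

section \<open>Excursions and the crossing protocol\<close>

definition side :: "nat \<Rightarrow> bool \<Rightarrow> nat set" where
  "side n b = (if b then {..n} else {2 * n <..})"

text \<open>\<open>True\<close> stands for the left. The separator cells \<open>n + 1\<close> to
  \<open>2 * n\<close> belong to neither side, and the port is the cell through which a side is
  entered from the separator.\<close>

definition port :: "nat \<Rightarrow> bool \<Rightarrow> nat" where
  "port n b = (if b then n else Suc (2 * n))"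

text \<open>Only the opposite side is frozen, so the head may roam over its own side and the
  separator until it has crossed completely.\<close>

definition excursion ::
    "('s, 'a) pfa2 \<Rightarrow> 'a list \<Rightarrow> nat \<Rightarrow> nat \<Rightarrow> bool \<Rightarrow> 's config \<Rightarrow> 's config pmf" where
  "excursion M w n T b = iter_pmf (freeze {c. snd c \<in> side n (\<not> b)} (pfa2_step M w)) T"

text \<open>Only the state is handed over: a head that has crossed the separator stands at the port, and
  in a halting state the position is irrelevant.\<close>

primrec protocol ::
    "('s, 'a) pfa2 \<Rightarrow> 'a list \<Rightarrow> nat \<Rightarrow> nat \<Rightarrow> nat \<Rightarrow> bool \<Rightarrow> 's config \<Rightarrow> 's pmf" where
  "protocol M w n T 0 b c = map_pmf fst (excursion M w n T b c)"
| "protocol M w n T (Suc k) b c =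
     bind_pmf (map_pmf fst (excursion M w n T b c)) (\<lambda>s. protocol M w n T k (\<not> b) (s, port n (\<not> b)))"

text \<open>A halting state passes unchanged through all remaining rounds, so runs with fewer than
  \<open>k\<close> crossings fit the same protocol.\<close>

lemma protocol_halting:
  assumes "halting M c"
  shows "protocol M w n T k b c = return_pmf (fst c)"
  using assms
proof (induction k arbitrary: b c)
  case (Suc k)
  have "excursion M w n T b c = return_pmf c" for b
    unfolding excursion_def using Suc.prems
    by (intro iter_pmf_return) (simp add: freeze_def pfa2_step_halting)
  moreover have "halting M (fst c, p)" for p using Suc.prems by (simp add: halting_def)
  ultimately show ?case using Suc.IH by (simp add: bind_return_pmf)
next
  case 0
  have "excursion M w n T b c = return_pmf c"
    unfolding excursion_def using 0
    by (intro iter_pmf_return) (simp add: freeze_def pfa2_step_halting)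
  then show ?case by simp
qed

lemma excursion_support:
  assumes "wf_pfa2 M" "fst c \<in> states M" "snd c \<in> side n b"
    and "c' \<in> set_pmf (excursion M w n T b c)"
  shows "fst c' \<in> states M" "snd c' \<in> side n (\<not> b) \<Longrightarrow> snd c' = port n (\<not> b)"
proof -
  let ?P = "\<lambda>c. fst c \<in> states M \<and> (snd c \<in> side n (\<not> b) \<longrightarrow> snd c = port n (\<not> b))"
  have "?P c'" using assms(4) unfolding excursion_def
  proof (rule iter_pmf_invariant)
    show "?P c" using assms(2,3) by (auto simp: side_def port_def split: if_splits)
  next
    fix c c' assume *: "?P c" "c' \<in> set_pmf (freeze {c. snd c \<in> side n (\<not> b)} (pfa2_step M w) c)"
    then have "c' = c \<or> snd c \<notin> side n (\<not> b) \<and> c' \<in> set_pmf (pfa2_step M w c)"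
      by (auto simp: freeze_def split: if_splits)
    with * show "?P c'"
      using pfa2_step_support[OF assms(1), of c c' w]
      by (auto simp: side_def port_def split: if_splits)
  qed
  then show "fst c' \<in> states M" "snd c' \<in> side n (\<not> b) \<Longrightarrow> snd c' = port n (\<not> b)" by auto
qed

text \<open>Between two ports the head needs more than \<open>n\<close> steps, so a run of length at most
  \<open>n + k * (n + 1)\<close> changes sides at most \<open>k\<close> times.\<close>

lemma outcome_eq_protocol:
  assumes wf: "wf_pfa2 M"
    and "fst c \<in> states M" "snd c \<in> side n b" "halts_within M w u c" "u \<le> T" "u \<le> n + k * Suc n"
  shows "outcome M w T c = protocol M w n T k b c"
  using assms(2-)
proof (induction k arbitrary: u b c)
  case (0 u b c)
  have "halting M c'" if "c' \<in> set_pmf (excursion M w n T b c)" for c'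
    using frozen_support[OF wf that[unfolded excursion_def] 0(1,3,4)] 0(2,5)
      by (auto simp: side_def split: if_splits)
  then have "bind_pmf (excursion M w n T b c) (outcome M w T)
      = bind_pmf (excursion M w n T b c) (\<lambda>c'. return_pmf (fst c'))"
    by (intro bind_pmf_cong) (auto simp: outcome_halting)
  then show ?case
    using outcome_freeze[OF halts_within_mono[OF 0(3,4)]] by (simp add: excursion_def map_pmf_def)
next
  case (Suc k u b c)
  have "outcome M w T c' = protocol M w n T k (\<not> b) (fst c', port n (\<not> b))"
    if c': "c' \<in> set_pmf (excursion M w n T b c)" for c'
  proof (cases "halting M c'")
    case True
    then have "halting M (fst c', port n (\<not> b))" by (simp add: halting_def)
    then show ?thesis using True by (simp add: outcome_halting protocol_halting)
  next
    case False
    with frozen_support[OF wf c'[unfolded excursion_def] Suc.prems(1,3,4)]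
    obtain d where d: "snd c' \<in> side n (\<not> b)" "d \<le> u" "halts_within M w (u - d) c'"
      "snd c' \<le> snd c + d" "snd c \<le> snd c' + d" by auto
    have "Suc n \<le> d" using d(1,4,5) Suc.prems(2) by (auto simp: side_def split: if_splits)
    with Suc.prems(5) have "u - d \<le> n + k * Suc n" by simp
    moreover have "c' = (fst c', port n (\<not> b))"
      using excursion_support[OF wf Suc.prems(1,2) c'] d(1) by (simp add: prod_eq_iff)
    ultimately show ?thesis
      using Suc.IH[of c' "\<not> b" "u - d"] excursion_support(1)[OF wf Suc.prems(1,2) c'] d Suc.prems(4)
      by simp
  qed
  then have "bind_pmf (excursion M w n T b c) (outcome M w T)
      = bind_pmf (excursion M w n T b c) (\<lambda>c'. protocol M w n T k (\<not> b) (fst c', port n (\<not> b)))"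
    by (intro bind_pmf_cong) auto
  then show ?case
    using outcome_freeze[OF halts_within_mono[OF Suc.prems(3,4)]]
    by (simp add: excursion_def bind_map_pmf)
qed

section \<open>Sums of few products: a form of nonnegative rank\<close>

definition factors :: "nat \<Rightarrow> nat \<Rightarrow> ('a list \<Rightarrow> 'a list \<Rightarrow> real) \<Rightarrow> bool" where
  "factors n N g \<longleftrightarrow> (\<exists>(I :: nat list set) a b. finite I \<and> card I \<le> N
     \<and> (\<forall>i\<in>I. \<forall>x. a i x \<in> {0..1} \<and> b i x \<in> {0..1})
     \<and> (\<forall>x y. length x = n \<longrightarrow> length y = n \<longrightarrow> g x y = (\<Sum>i\<in>I. a i x * b i y)))"

lemma factors_swap: "factors n N g \<Longrightarrow> factors n N (\<lambda>x y. g y x)"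
  unfolding factors_def
  apply (elim exE conjE)
  subgoal for I a b by (intro exI[of _ I] exI[of _ b] exI[of _ a]) (auto simp: mult.commute)
  done

lemma factors_one:
  assumes "\<And>x. f x \<in> {0..1}"
  shows "factors n 1 (\<lambda>x y. f x)"
  unfolding factors_def using assms
  by (intro exI[of _ "{[]}"] exI[of _ "\<lambda>i. f"] exI[of _ "\<lambda>i x. 1"]) auto

text \<open>Prefixing \<open>s\<close> to the indices of the \<open>s\<close>-th factorization keeps
  the index sets disjoint. With \<open>s\<close> a crossing state, the indices become crossing
  sequences.\<close>

lemma factors_sum:
  fixes S :: "nat set"
  assumes "finite S" "\<And>s x. f s x \<in> {0..1}" "\<And>s. s \<in> S \<Longrightarrow> factors n N (g s)"
  shows "factors n (card S * N) (\<lambda>x y. \<Sum>s\<in>S. f s x * g s x y)"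
proof -
  have "\<forall>s\<in>S. \<exists>I a b. finite (I :: nat list set) \<and> card I \<le> N
     \<and> (\<forall>i\<in>I. \<forall>x. a i x \<in> {0..1} \<and> b i x \<in> {0..1})
     \<and> (\<forall>x y. length x = n \<longrightarrow> length y = n \<longrightarrow> g s x y = (\<Sum>i\<in>I. a i x * b i y))"
    using assms(3) unfolding factors_def by blast
  then obtain I a b where *: "\<forall>s\<in>S. finite (I s :: nat list set) \<and> card (I s) \<le> N
     \<and> (\<forall>i\<in>I s. \<forall>x. a s i x \<in> {0..1} \<and> b s i x \<in> {0..1})
     \<and> (\<forall>x y. length x = n \<longrightarrow> length y = n \<longrightarrow> g s x y = (\<Sum>i\<in>I s. a s i x * b s i y))"
    unfolding bchoice_iff by blast
  let ?c = "\<lambda>(s, i). s # i"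
  let ?J = "?c ` Sigma S I"
  have inj: "inj_on ?c (Sigma S I)" by (auto simp: inj_on_def)
  have "finite ?J" using assms(1) * by auto
  moreover have "card ?J \<le> card S * N"
  proof -
    have "card ?J = (\<Sum>s\<in>S. card (I s))" using assms(1) * by (simp add: card_image[OF inj])
    also have "\<dots> \<le> card S * N" using sum_bounded_above[of S "\<lambda>s. card (I s)" N] * by simp
    finally show ?thesis .
  qed
  moreover have "f (hd l) x * a (hd l) (tl l) x \<in> {0..1} \<and> b (hd l) (tl l) x \<in> {0..1}"
    if "l \<in> ?J" for l x
    using * assms(2) that by (fastforce intro!: mult_le_one)
  moreover have "(\<Sum>s\<in>S. f s x * g s x y)
        = (\<Sum>l\<in>?J. f (hd l) x * a (hd l) (tl l) x * b (hd l) (tl l) y)"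
    if l: "length x = n" "length y = n" for x y
  proof -
    have "(\<Sum>s\<in>S. f s x * g s x y) = (\<Sum>s\<in>S. \<Sum>i\<in>I s. f s x * a s i x * b s i y)"
      using * l by (intro sum.cong refl) (simp add: sum_distrib_left mult.assoc)
    also have "\<dots> = (\<Sum>(s, i)\<in>Sigma S I. f s x * a s i x * b s i y)"
      using assms(1) * by (intro sum.Sigma) auto
    also have "\<dots> = (\<Sum>l\<in>?J. f (hd l) x * a (hd l) (tl l) x * b (hd l) (tl l) y)"
      by (subst sum.reindex[OF inj]) (simp add: case_prod_unfold)
    finally show ?thesis .
  qed
  ultimately show ?thesis unfolding factors_def
    by (intro exI[of _ ?J] exI[of _ "\<lambda>l x. f (hd l) x * a (hd l) (tl l) x"]
      exI[of _ "\<lambda>l y. b (hd l) (tl l) y"] conjI ballI allI impI) simp_all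
qed

lemma factors_cong:
  assumes "factors n N g" "\<And>x y. length x = n \<Longrightarrow> length y = n \<Longrightarrow> h x y = g x y"
  shows "factors n N h"
  using assms(1) unfolding factors_def
  apply (elim exE conjE)
  subgoal for I a b by (intro exI[of _ I] exI[of _ a] exI[of _ b]) (simp add: assms(2))
  done

lemma prob_bind_pmf:
  assumes "finite S" "set_pmf p \<subseteq> S"
  shows "measure_pmf.prob (bind_pmf p f) A = (\<Sum>s\<in>S. pmf p s * measure_pmf.prob (f s) A)"
proof -
  have "ennreal (measure_pmf.prob (bind_pmf p f) A) = (\<integral>\<^sup>+s. ennreal (measure_pmf.prob (f s) A) \<partial>p)"
    by (simp flip: measure_pmf.emeasure_eq_measure)
  also have "\<dots> = (\<Sum>s\<in>S. ennreal (measure_pmf.prob (f s) A) * ennreal (pmf p s))"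
    using assms by (intro nn_integral_measure_pmf_support) auto
  also have "\<dots> = ennreal (\<Sum>s\<in>S. pmf p s * measure_pmf.prob (f s) A)"
    by (subst sum_ennreal[symmetric]) (auto simp: ennreal_mult mult.commute)
  finally show ?thesis by (simp add: sum_nonneg)
qed

abbreviation separated :: "nat \<Rightarrow> letter list \<Rightarrow> letter list \<Rightarrow> letter list" where
  "separated n x y \<equiv> x @ replicate n Hash @ y"

lemma excursion_local:
  assumes "length x = n" "length y = n"
  shows "excursion M (separated n x y) n T b
    = excursion M (let z = (if b then x else y) in separated n z z) n T b"
proof -
  have "pfa2_step M (separated n x y) c
      = pfa2_step M (let z = (if b then x else y) in separated n z z) c"
    if "snd c \<notin> side n (\<not> b)" for c
  proof -
    have "tape (separated n x y) (snd c)
        = tape (let z = (if b then x else y) in separated n z z) (snd c)"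
      using that assms by (auto simp: tape_def side_def nth_append Let_def split: if_splits)
    then show ?thesis by (simp add: pfa2_step_def)
  qed
  then show ?thesis unfolding excursion_def
    by (intro arg_cong[where f = "\<lambda>K. iter_pmf K T"] ext) (simp add: freeze_def)
qed

text \<open>Conditioning on the state handed over gives a sum of products of a function of one word
  and a shorter protocol. The two words alternate in this role, hence the uses of
  \<open>factors_swap\<close>. The last excursion hands over nothing and contributes one term, so
  the exponent is \<open>k\<close> although there are \<open>k + 1\<close> excursions.\<close>

lemma factors_protocol:
  assumes wf: "wf_pfa2 (M :: (nat, letter) pfa2)"
    and "fst c \<in> states M" "snd c \<in> side n b"
  shows "factors n (card (states M) ^ k)
    (\<lambda>x y. measure_pmf.prob (protocol M (separated n x y) n T k b c) A)"
  using assms(2-)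
proof (induction k arbitrary: b c)
  case 0
  define f where "f z = measure_pmf.prob (map_pmf fst (excursion M (separated n z z) n T b c)) A" for z
  have "factors n 1 (\<lambda>x y. f x)" by (rule factors_one) (simp add: f_def)
  then have "factors n 1 (\<lambda>x y. if b then f x else f y)"
    using factors_swap[of n 1 "\<lambda>x y. f x"] by (cases b) auto
  then show ?case
    by (simp, elim factors_cong) (subst excursion_local, auto simp: f_def)
next
  case (Suc k)
  define f where "f s z = pmf (map_pmf fst (excursion M (separated n z z) n T b c)) s" for s z
  define g where "g s x y =
    measure_pmf.prob (protocol M (separated n x y) n T k (\<not> b) (s, port n (\<not> b))) A" for s x y
  have fin: "finite (states M)" using wf by (simp add: wf_pfa2_def wf_control_def)
  have f: "f s x \<in> {0..1}" for s x by (simp add: f_def pmf_le_1)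
  have g: "factors n (card (states M) ^ k) (g s)" if "s \<in> states M" for s
    unfolding g_def using that by (intro Suc.IH) (auto simp: port_def side_def)
  have "factors n (card (states M) * card (states M) ^ k)
      (\<lambda>x y. \<Sum>s\<in>states M. (if b then f s x else f s y) * g s x y)"
  proof (cases b)
    case True
    then show ?thesis using factors_sum[of _ f, OF fin f g] by simp
  next
    case False
    have "factors n (card (states M) * card (states M) ^ k)
      (\<lambda>x y. \<Sum>s\<in>states M. f s x * g s y x)"
      by (rule factors_sum[of _ f, OF fin f factors_swap[OF g]])
    from factors_swap[OF this] show ?thesis using False by simp
  qed
  then have "factors n (card (states M) ^ Suc k)
      (\<lambda>x y. \<Sum>s\<in>states M. (if b then f s x else f s y) * g s x y)" by simp
  then show ?case
  proof (rule factors_cong)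
    fix x y :: "letter list" assume l: "length x = n" "length y = n"
    let ?p = "map_pmf fst (excursion M (separated n x y) n T b c)"
    have "set_pmf ?p \<subseteq> states M" using excursion_support(1)[OF wf Suc.prems] by auto
    then have "measure_pmf.prob (protocol M (separated n x y) n T (Suc k) b c) A
        = (\<Sum>s\<in>states M. pmf ?p s * g s x y)"
      by (simp add: prob_bind_pmf[OF fin] g_def)
    moreover have "pmf ?p s = (if b then f s x else f s y)" for s
      by (subst excursion_local[OF l]) (simp add: f_def)
    ultimately show "measure_pmf.prob (protocol M (separated n x y) n T (Suc k) b c) A
        = (\<Sum>s\<in>states M. (if b then f s x else f s y) * g s x y)" by simp
  qed
qed

section \<open>The acceptance probability at the time bound\<close>

lemma pfa2_time_halts:
  assumes "pfa2_time M = enat T"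
  shows "halts_within M w T (start M, 0)"
proof -
  let ?X = "{t. \<forall>c\<in>set_pmf (pfa2_run M w t). halting M c}"
  have "pfa2_steps M w \<le> enat T"
    using assms unfolding pfa2_time_def by (metis SUP_upper UNIV_I)
  then have *: "(INF t\<in>?X. enat t) < enat (Suc T)"
    by (simp add: pfa2_steps_def order.strict_trans1)
  then obtain t where "t \<in> ?X" "t \<le> T" unfolding INF_less_iff by auto
  then show ?thesis
    using halts_within_mono[of M w t] by (auto simp: halts_within_def pfa2_run_eq_iter)
qed

text \<open>Accepting configurations are absorbing, so the probabilities increase with
  \<open>t\<close>; they are constant from \<open>T\<close> on, so the supremum is attained at
  \<open>T\<close>.\<close>

lemma pfa2_accept_prob_outcome:
  assumes "halts_within M w T (start M, 0)"
  shows "pfa2_accept_prob M w = measure_pmf.prob (outcome M w T (start M, 0)) (acc M)"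
proof -
  let ?P = "\<lambda>t. measure_pmf.prob (pfa2_run M w t) {c. accepting M c}"
  have mono: "?P t \<le> ?P (Suc t)" for t
  proof -
    have "emeasure (pfa2_run M w t) {c. accepting M c} = (\<integral>\<^sup>+c. indicator {c. accepting M c} c \<partial>pfa2_run M w t)"
      by simp
    also have "\<dots> \<le> (\<integral>\<^sup>+c. emeasure (pfa2_step M w c) {c. accepting M c} \<partial>pfa2_run M w t)"
      by (intro nn_integral_mono)
        (auto simp: indicator_def pfa2_step_def halting_def accepting_def)
    also have "\<dots> = emeasure (pfa2_run M w (Suc t)) {c. accepting M c}" by simp
    finally show ?thesis by (simp add: measure_pmf.emeasure_eq_measure)
  qed
  have "incseq ?P" using mono by (rule incseq_SucI)
  have "?P t \<le> ?P T" for t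
  proof (cases "t \<le> T")
    case True then show ?thesis using incseqD[OF \<open>incseq ?P\<close>] by blast
  next
    case False then show ?thesis
      using iter_pmf_halted[OF assms, of t] by (simp add: pfa2_run_eq_iter)
  qed
  then have "(SUP t. ?P t) = ?P T" by (intro cSup_eq_maximum) auto
  then show ?thesis
    by (simp add: pfa2_accept_prob_def outcome_def pfa2_run_eq_iter vimage_def accepting_def)
qed

text \<open>The number of rounds is \<open>T div Suc n\<close>: the remainder of this division is at
  most \<open>n\<close>, which is exactly the slack in \<open>outcome_eq_protocol\<close>. The run
  starts at cell \<open>0\<close>, on the left side.\<close>

lemma factors_accept_prob:
  assumes "wf_pfa2 (M :: (nat, letter) pfa2)" "pfa2_time M = enat T"
  shows "factors n (card (states M) ^ (T div Suc n)) (\<lambda>x y. pfa2_accept_prob M (separated n x y))"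
proof -
  have s: "fst (start M, 0::nat) \<in> states M" "snd (start M, 0::nat) \<in> side n True"
    using assms(1) by (auto simp: wf_pfa2_def wf_control_def side_def)
  have "T = T div Suc n * Suc n + T mod Suc n" by (rule div_mult_mod_eq[symmetric])
  then have le: "T \<le> n + T div Suc n * Suc n" using mod_less_divisor[of "Suc n" T] by linarith
  show ?thesis
    using factors_protocol[OF assms(1) s]
  proof (rule factors_cong)
    fix x y :: "letter list"
    note h = pfa2_time_halts[OF assms(2)]
    show "pfa2_accept_prob M (separated n x y) = measure_pmf.prob
       (protocol M (separated n x y) n T (T div Suc n) True (start M, 0)) (acc M)"
      unfolding pfa2_accept_prob_outcome[OF h]
        outcome_eq_protocol[OF assms(1) s h order_refl le] ..
  qed
qed

section \<open>Lower bounds\<close>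

definition pfa_of_dfa :: "('s, 'a) dfa2 \<Rightarrow> ('s, 'a) pfa2" where
  "pfa_of_dfa M = \<lparr>states = states M, start = start M, acc = acc M, rej = rej M,
     ptrans = (\<lambda>s a. return_pmf (dtrans M s a))\<rparr>"

lemma pfa_of_dfa_simps [simp]:
  "states (pfa_of_dfa M) = states M" "start (pfa_of_dfa M) = start M"
  "acc (pfa_of_dfa M) = acc M" "rej (pfa_of_dfa M) = rej M"
  "ptrans (pfa_of_dfa M) s a = return_pmf (dtrans M s a)"
  "halting (pfa_of_dfa M) c = halting M c" "accepting (pfa_of_dfa M) c = accepting M c"
  "space_of (pfa_of_dfa M) = space_of M"
  by (simp_all add: pfa_of_dfa_def halting_def accepting_def space_of_def)

lemma wf_pfa_of_dfa [simp]: "wf_pfa2 (pfa_of_dfa M) \<longleftrightarrow> wf_dfa2 M"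
  by (simp add: wf_pfa2_def wf_dfa2_def wf_control_def legal_moves_def)

lemma pfa2_run_pfa_of_dfa [simp]: "pfa2_run (pfa_of_dfa M) w t = return_pmf (dfa2_run M w t)"
  by (induction t)
    (simp_all add: dfa2_run_def bind_return_pmf pfa2_step_def dfa2_step_def)

lemma pfa2_accept_prob_pfa_of_dfa [simp]:
  "pfa2_accept_prob (pfa_of_dfa M) w = of_bool (dfa2_accepts M w)"
proof (cases "dfa2_accepts M w")
  case True
  then obtain t where "accepting M (dfa2_run M w t)" by (auto simp: dfa2_accepts_def)
  then have "(SUP t. indicator {c. accepting M c} (dfa2_run M w t) :: real) = 1"
    by (intro cSup_eq_maximum) (auto simp: indicator_def intro!: image_eqI[of _ _ t])
  then show ?thesis using True by (simp add: pfa2_accept_prob_def)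
next
  case False
  then show ?thesis by (simp add: pfa2_accept_prob_def dfa2_accepts_def)
qed

lemma pfa2_TS_pfa_of_dfa [simp]: "pfa2_TS (pfa_of_dfa M) = dfa2_TS M"
  by (simp add: pfa2_TS_def dfa2_TS_def pfa2_time_def dfa2_time_def pfa2_steps_def dfa2_steps_def)

text \<open>This excludes the product \<open>\<infinity> * 0\<close>: an accepting state exists, and
  it differs from the start state, since a halting start state would give time
  \<open>0\<close>.\<close>

lemma pfa2_two_states:
  assumes "wf_pfa2 M" "pfa2_accept_prob M w > 0" "pfa2_time M = \<infinity>"
  shows "2 \<le> card (states M)"
proof -
  have "acc M \<noteq> {}"
    using assms(2) by (auto simp: pfa2_accept_prob_def accepting_def)
  then obtain q where q: "q \<in> acc M" by auto
  have "\<not> halting M (start M, 0)"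
  proof
    assume "halting M (start M, 0)"
    then have "pfa2_steps M w \<le> enat 0" for w
      unfolding pfa2_steps_def by (intro INF_lower) simp
    then have "pfa2_time M \<le> enat 0" unfolding pfa2_time_def by (rule SUP_least)
    with assms(3) show False by simp
  qed
  with q have "q \<noteq> start M" by (auto simp: halting_def)
  moreover have "{q, start M} \<subseteq> states M" "finite (states M)"
    using assms(1) q by (auto simp: wf_pfa2_def wf_control_def)
  ultimately show ?thesis using card_mono[of "states M" "{q, start M}"] by simp
qed

text \<open>Reduces a lower bound to automata of finite time. With infinite time the space is
  positive by \<open>pfa2_two_states\<close>, so the product is infinite.\<close>

lemma pfa2_TS_ge:
  assumes "wf_pfa2 M" "pfa2_accept_prob M w > 0"
    and "\<And>T. pfa2_time M = enat T \<Longrightarrow> r \<le> real T * space_of M"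
  shows "ennreal r \<le> pfa2_TS M"
proof (cases "pfa2_time M")
  case (enat T)
  have "ennreal r \<le> ennreal (real T * space_of M)" by (rule ennreal_leI) (rule assms(3)[OF enat])
  also have "\<dots> \<le> ennreal (real T) * ennreal (space_of M)"
    by (cases "space_of M \<ge> 0") (simp_all add: ennreal_mult mult_nonneg_nonpos ennreal_neg)
  finally show ?thesis by (simp add: pfa2_TS_def enat ennreal_of_nat_eq_real_of_nat)
next
  case infinity
  have "0 < space_of M"
    using pfa2_two_states[OF assms(1,2) infinity] by (simp add: space_of_def)
  then show ?thesis by (simp add: pfa2_TS_def infinity ennreal_top_mult)
qed

section \<open>Lower bounds on the number of products\<close>

definition bits :: "nat \<Rightarrow> letter list set" where
  "bits n = {x. set x \<subseteq> {Zero, One} \<and> length x = n}"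

lemma finite_bits: "finite (bits n)"
  unfolding bits_def by (rule finite_lists_length_eq) simp

lemma card_bits: "card (bits n) = 2 ^ n"
  unfolding bits_def by (subst card_lists_length_eq) (auto simp: numeral_2_eq_2)

lemma L_EQ_alt: "L_EQ n = (\<lambda>x. separated n x x) ` bits n"
  by (auto simp: L_EQ_def bits_def)

lemma separated_in_L_EQ_iff:
  "x \<in> bits n \<Longrightarrow> y \<in> bits n \<Longrightarrow> separated n x y \<in> L_EQ n \<longleftrightarrow> x = y"
  by (auto simp: L_EQ_alt bits_def)

lemma factorsE:
  assumes "factors n N g"
  obtains I :: "nat list set" and a b where "finite I" "card I \<le> N"
    "\<And>i x. i \<in> I \<Longrightarrow> 0 \<le> a i x \<and> a i x \<le> 1" "\<And>i x. i \<in> I \<Longrightarrow> 0 \<le> b i x \<and> b i x \<le> 1"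
    "\<And>x y. length x = n \<Longrightarrow> length y = n \<Longrightarrow> g x y = (\<Sum>i\<in>I. a i x * b i y)"
proof -
  from assms obtain I :: "nat list set" and a b where "finite I \<and> card I \<le> N
     \<and> (\<forall>i\<in>I. \<forall>x. a i x \<in> {0..1} \<and> b i x \<in> {0..1})
     \<and> (\<forall>x y. length x = n \<longrightarrow> length y = n \<longrightarrow> g x y = (\<Sum>i\<in>I. a i x * b i y))"
    unfolding factors_def by (elim exE)
  then show ?thesis using that[of I a b] by simp
qed

text \<open>Each positive diagonal entry has an index with a positive term. Were an index shared by
  \<open>x\<close> and \<open>y\<close>, its term would be positive at \<open>(x, y)\<close> too,
  and nonnegativity of the other terms forbids cancellation.\<close>

lemma factors_fooling_set:
  assumes "factors n N g" "finite X" "\<And>x. x \<in> X \<Longrightarrow> length x = n"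
    and pos: "\<And>x. x \<in> X \<Longrightarrow> g x x > 0"
    and zero: "\<And>x y. x \<in> X \<Longrightarrow> y \<in> X \<Longrightarrow> x \<noteq> y \<Longrightarrow> g x y = 0"
  shows "card X \<le> N"
proof -
  from assms(1) obtain I :: "nat list set" and a b where I: "finite I" "card I \<le> N"
    and a: "\<And>i x. i \<in> I \<Longrightarrow> 0 \<le> a i x \<and> a i x \<le> 1"
    and b: "\<And>i x. i \<in> I \<Longrightarrow> 0 \<le> b i x \<and> b i x \<le> 1"
    and g: "\<And>x y. length x = n \<Longrightarrow> length y = n \<Longrightarrow> g x y = (\<Sum>i\<in>I. a i x * b i y)"
    by (rule factorsE) (rule that)
  note ab = a b
  note g = g[OF assms(3) assms(3)]
  have "\<exists>i. i \<in> I \<and> 0 < a i x * b i x" if "x \<in> X" for x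
  proof (rule ccontr)
    assume "\<not> ?thesis"
    then have "g x x \<le> 0" using that by (auto simp: g not_less intro!: sum_nonpos)
    then show False using pos[OF that] by simp
  qed
  then obtain f where f: "\<And>x. x \<in> X \<Longrightarrow> f x \<in> I \<and> 0 < a (f x) x * b (f x) x" by metis
  have "inj_on f X"
  proof (rule inj_onI, rule ccontr)
    fix x y assume *: "x \<in> X" "y \<in> X" "f x = f y" "x \<noteq> y"
    have "0 < a (f x) x" "0 < b (f x) y"
      using f[OF *(1)] f[OF *(2)] a[of "f x" x] b[of "f x" y] *(3)
      by (auto simp: zero_less_mult_iff)
    then have "0 < a (f x) x * b (f x) y" by simp
    also have "\<dots> \<le> g x y"
      unfolding g[OF *(1,2)] using f[OF *(1)] ab by (intro member_le_sum I) auto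
    finally show False using zero[OF *(1,2,4)] by simp
  qed
  then have "card X \<le> card I" using f I(1) by (intro card_inj_on_le[of f]) auto
  with I(2) show ?thesis by simp
qed

text \<open>Two words whose left factors agree up to \<open>1 / (4 * N)\<close> are accepted together with any fixed
  right half with probabilities that differ by at most \<open>1/4\<close>.\<close>

lemma factors_bounded_error:
  assumes "factors n N g" "finite X" "\<And>x. x \<in> X \<Longrightarrow> length x = n" "N > 0"
    and large: "\<And>x. x \<in> X \<Longrightarrow> g x x \<ge> 2/3"
    and small: "\<And>x y. x \<in> X \<Longrightarrow> y \<in> X \<Longrightarrow> x \<noteq> y \<Longrightarrow> g x y \<le> 1/3"
  shows "card X \<le> (4 * N + 1) ^ N"
proof -
  from assms(1) obtain I :: "nat list set" and a b where I: "finite I" "card I \<le> N"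
    and a: "\<And>i x. i \<in> I \<Longrightarrow> 0 \<le> a i x \<and> a i x \<le> 1"
    and b: "\<And>i x. i \<in> I \<Longrightarrow> 0 \<le> b i x \<and> b i x \<le> 1"
    and g: "\<And>x y. length x = n \<Longrightarrow> length y = n \<Longrightarrow> g x y = (\<Sum>i\<in>I. a i x * b i y)"
    by (rule factorsE) (rule that)
  note ab = a b
  note g = g[OF assms(3) assms(3)]
  define f where "f x = restrict (\<lambda>i. nat \<lfloor>4 * real N * a i x\<rfloor>) I" for x
  have "inj_on f X"
  proof (rule inj_onI, rule ccontr)
    fix x y assume *: "x \<in> X" "y \<in> X" "f x = f y" "x \<noteq> y"
    have "a i y * b i y - a i x * b i y \<le> 1 / (4 * real N)" if i: "i \<in> I" for i
    proof -
      have "nat \<lfloor>4 * real N * a i x\<rfloor> = nat \<lfloor>4 * real N * a i y\<rfloor>"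
        using fun_cong[OF *(3), of i] i by (simp add: f_def)
      then have "\<lfloor>4 * real N * a i x\<rfloor> = \<lfloor>4 * real N * a i y\<rfloor>"
        using a[OF i] by (subst (asm) eq_nat_nat_iff) auto
      then have "4 * real N * a i y - 4 * real N * a i x \<le> 1" by linarith
      then have "a i y - a i x \<le> 1 / (4 * real N)"
        using \<open>N > 0\<close> by (simp add: field_simps)
      then have "(a i y - a i x) * b i y \<le> 1 / (4 * real N) * b i y"
        using ab[OF i] by (intro mult_right_mono) auto
      also have "\<dots> \<le> 1 / (4 * real N) * 1"
        using ab[OF i] by (intro mult_left_mono) auto
      finally show ?thesis by (simp add: algebra_simps)
    qed
    then have "g y y - g x y \<le> (\<Sum>i\<in>I. 1 / (4 * real N))"
      using * by (simp only: g sum_subtractf[symmetric]) (rule sum_mono)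
    also have "\<dots> \<le> real N * (1 / (4 * real N))"
      unfolding sum_constant using I(2) by (intro mult_right_mono) auto
    also have "\<dots> = 1/4" using \<open>N > 0\<close> by simp
    \<comment> \<open>The diagonal entry is at least 2/3 and the off-diagonal one at most 1/3; this
      gap exceeds 1/4.\<close>
    finally show False using large[OF *(2)] small[OF *(1,2,4)] by linarith
  qed
  moreover have "f ` X \<subseteq> PiE I (\<lambda>_. {..4 * N})"
  proof (intro image_subsetI PiE_I)
    fix x i assume "i \<in> I"
    have "4 * real N * a i x \<le> 4 * real N * 1" using ab[OF \<open>i \<in> I\<close>] by (intro mult_left_mono) auto
    then show "f x i \<in> {..4 * N}" using \<open>i \<in> I\<close> by (simp add: f_def) linarith
  qed (simp add: f_def)
  ultimately have "card X \<le> card (PiE I (\<lambda>_. {..4 * N}))"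
    using I(1) by (intro card_inj_on_le[of f]) (auto intro!: finite_PiE)
  also have "\<dots> = (4 * N + 1) ^ card I" using I(1) by (simp add: card_PiE)
  also have "\<dots> \<le> (4 * N + 1) ^ N" using I(2) by (intro power_increasing) auto
  finally show ?thesis .
qed

lemma pfa2_card_states_pos: "wf_pfa2 M \<Longrightarrow> card (states M) > 0"
  by (auto simp: wf_pfa2_def wf_control_def card_gt_0_iff)

text \<open>Each crossing state carries \<open>space_of M\<close> bits and is paid for with at least
  \<open>n\<close> steps, since \<open>n * (T div Suc n) \<le> T\<close>. A bound on the number of
  crossing sequences thus becomes a bound on time times space.\<close>

lemma log_crossings_le:
  assumes "wf_pfa2 M"
  shows "real n * log 2 (real (card (states M) ^ (T div Suc n))) \<le> real T * space_of M"
proof -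
  have "1 \<le> real (card (states M))" using pfa2_card_states_pos[OF assms] by simp
  then have s: "0 \<le> space_of M" by (simp add: space_of_def)
  have "n * (T div Suc n) \<le> Suc n * (T div Suc n)" by simp
  also have "\<dots> \<le> T" by (rule times_div_less_eq_dividend)
  finally have "real n * real (T div Suc n) \<le> real T" by (simp flip: of_nat_mult)
  from mult_right_mono[OF this s] show ?thesis
    using pfa2_card_states_pos[OF assms] by (simp add: log_nat_power space_of_def)
qed

lemma TS_2DFA_L_EQ_ge: "ennreal (real n ^ 2) \<le> TS_2DFA (L_EQ n)"
  unfolding TS_2DFA_def
proof (rule INF_greatest, clarify)
  fix M :: "(nat, letter) dfa2" assume rec: "dfa2_recognizes M (L_EQ n)"
  let ?P = "pfa_of_dfa M"
  have wf: "wf_pfa2 ?P" using rec by (simp add: dfa2_recognizes_def)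
  have accepts: "dfa2_accepts M w \<longleftrightarrow> w \<in> L_EQ n" for w
    using rec by (simp add: dfa2_recognizes_def)
  obtain x where "x \<in> bits n" using card_bits[of n] by fastforce
  then have "pfa2_accept_prob ?P (separated n x x) > 0"
    by (simp add: accepts separated_in_L_EQ_iff)
  from wf this have "ennreal (real n ^ 2) \<le> pfa2_TS ?P"
  proof (rule pfa2_TS_ge)
    fix T assume T: "pfa2_time ?P = enat T"
    let ?N = "card (states ?P) ^ (T div Suc n)"
    from factors_accept_prob[OF wf T, of n] finite_bits have "card (bits n) \<le> ?N"
      by (rule factors_fooling_set) (auto simp: accepts separated_in_L_EQ_iff, auto simp: bits_def)
    then have "(2::real) ^ n \<le> real ?N"
      using of_nat_mono[of "card (bits n)" ?N, where 'a = real] by (simp add: card_bits)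
    then have "log 2 (2 ^ n) \<le> log 2 (real ?N)" by (intro log_mono) auto
    then have "real n * real n \<le> real n * log 2 (real ?N)" by (intro mult_left_mono) auto
    also have "\<dots> \<le> real T * space_of ?P" by (rule log_crossings_le[OF wf])
    finally show "real n ^ 2 \<le> real T * space_of ?P" by (simp add: power2_eq_square)
  qed
  then show "ennreal (real n ^ 2) \<le> dfa2_TS M" by simp
qed

lemma TS_2PFA_L_EQ_ge:
  assumes "n \<ge> 64"
  shows "ennreal (real n * log 2 (real n) / 4) \<le> TS_2PFA (L_EQ n)"
  unfolding TS_2PFA_def
proof (rule INF_greatest, clarify)
  fix M :: "(nat, letter) pfa2" and \<epsilon> :: real
  assume \<epsilon>: "0 \<le> \<epsilon>" "\<epsilon> \<le> 1/3" and rec: "pfa2_recognizes \<epsilon> M (L_EQ n)"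
  then have wf: "wf_pfa2 M" by (simp add: pfa2_recognizes_def)
  have large: "pfa2_accept_prob M (separated n x x) \<ge> 2/3" if "x \<in> bits n" for x
  proof -
    have "separated n x x \<in> L_EQ n" using that by (simp add: separated_in_L_EQ_iff)
    then have "pfa2_accept_prob M (separated n x x) \<ge> 1 - \<epsilon>"
      using rec unfolding pfa2_recognizes_def by blast
    then show ?thesis using \<epsilon> by simp
  qed
  have small: "pfa2_accept_prob M (separated n x y) \<le> 1/3"
    if "x \<in> bits n" "y \<in> bits n" "x \<noteq> y" for x y
  proof -
    have "separated n x y \<notin> L_EQ n" using that by (simp add: separated_in_L_EQ_iff)
    then have "pfa2_accept_prob M (separated n x y) \<le> \<epsilon>"
      using rec unfolding pfa2_recognizes_def by blast
    then show ?thesis using \<epsilon> by simp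
  qed
  obtain x where "x \<in> bits n" using card_bits[of n] by fastforce
  then have "pfa2_accept_prob M (separated n x x) > 0" using large by fastforce
  with wf show "ennreal (real n * log 2 (real n) / 4) \<le> pfa2_TS M"
  proof (rule pfa2_TS_ge)
    fix T assume T: "pfa2_time M = enat T"
    define N where "N = card (states M) ^ (T div Suc n)"
    have "N > 0" using pfa2_card_states_pos[OF wf] by (simp add: N_def)
    have "card (bits n) \<le> (4 * N + 1) ^ N"
    proof (rule factors_bounded_error)
      show "factors n N (\<lambda>x y. pfa2_accept_prob M (separated n x y))"
        unfolding N_def by (rule factors_accept_prob[OF wf T])
    qed (use finite_bits \<open>N > 0\<close> large small in \<open>auto simp: bits_def\<close>)
    \<comment> \<open>The crude bound \<open>m < 2 ^ m\<close> suffices: it leads to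
      \<open>n \<le> 8 * N ^ 2\<close>, hence to \<open>log N\<close> of order
      \<open>log n\<close>.\<close>
    also have "\<dots> \<le> (2 ^ (4 * N + 1)) ^ N"
      by (intro power_mono less_imp_le less_exp) simp
    finally have "(2::nat) ^ n \<le> 2 ^ ((4 * N + 1) * N)" by (simp only: card_bits power_mult)
    then have "n \<le> (4 * N + 1) * N" by simp
    also have "\<dots> \<le> 8 * N ^ 2" using \<open>N > 0\<close> by (simp add: power2_eq_square algebra_simps)
    finally have "real n \<le> 8 * real N ^ 2"
      by (metis of_nat_le_iff of_nat_mult of_nat_numeral of_nat_power)
    then have "log 2 (real n) \<le> log 2 (8 * real N ^ 2)" using assms by (intro log_mono) auto
    also have "\<dots> = log 2 (2 ^ 3) + 2 * log 2 (real N)"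
      using \<open>N > 0\<close> by (simp add: log_mult log_nat_power)
    also have "log 2 (2 ^ 3 :: real) = 3" by (subst log_pow_cancel) auto
    finally have "log 2 (real n) \<le> 3 + 2 * log 2 (real N)" .
    moreover have "6 \<le> log 2 (real n)"
    proof -
      have "(6::real) = log 2 (2 ^ 6)" by (subst log_pow_cancel) auto
      also have "\<dots> \<le> log 2 (real n)" using assms by (intro log_mono) auto
      finally show ?thesis .
    qed
    \<comment> \<open>The threshold \<open>n \<ge> 64\<close> gives
      \<open>3 \<le> log 2 n / 2\<close>, which absorbs the additive constant.\<close>
    ultimately have "log 2 (real n) / 4 \<le> log 2 (real N)" by linarith
    then have "real n * (log 2 (real n) / 4) \<le> real n * log 2 (real N)"
      by (intro mult_left_mono) auto
    also have "\<dots> \<le> real T * space_of M" unfolding N_def by (rule log_crossings_le[OF wf])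
    finally show "real n * log 2 (real n) / 4 \<le> real T * space_of M" by simp
  qed
qed

section \<open>Hash families\<close>

definition hash :: "(nat \<Rightarrow> nat) \<Rightarrow> letter list \<Rightarrow> nat" where
  "hash c x = (\<Sum>i<length x. if x ! i = One then c i else 0)"

lemma bits_nth:
  assumes "x \<in> bits n" "i < n"
  shows "x ! i = Zero \<or> x ! i = One"
proof -
  have "x ! i \<in> set x" using assms by (intro nth_mem) (simp add: bits_def)
  then show ?thesis using assms unfolding bits_def by blast
qed

text \<open>At a position \<open>k\<close> where the words differ, \<open>c k\<close> enters only
  one of the two hashes, with coefficient one. A collision therefore determines \<open>c k\<close>
  modulo \<open>q\<close> from the other coefficients, for any positive \<open>q\<close>, prime or
  not.\<close>

lemma card_hash_collisions:
  assumes xy: "x \<in> bits n" "y \<in> bits n" "x \<noteq> y" and "q > 0"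
  shows "q * card {c \<in> PiE {..<n} (\<lambda>_. {..<q}). [hash c x = hash c y] (mod q)} \<le> q ^ n"
proof -
  let ?C = "{c \<in> PiE {..<n} (\<lambda>_. {..<q}). [hash c x = hash c y] (mod q)}"
  have l: "length x = n" "length y = n" using xy by (auto simp: bits_def)
  then obtain k where k: "k < n" "x ! k \<noteq> y ! k" using xy(3) by (metis nth_equalityI)
  then have k': "x ! k = One \<and> y ! k = Zero \<or> x ! k = Zero \<and> y ! k = One"
    using bits_nth[OF xy(1)] bits_nth[OF xy(2)] by metis
  define h where "h c z = (\<Sum>i\<in>{..<n} - {k}. if z ! i = One then c i else 0)"
    for c :: "nat \<Rightarrow> nat" and z
  have hash: "hash c z = (if z ! k = One then c k else 0) + h c z" if "length z = n" for c z
    unfolding hash_def h_def that using k(1) by (intro sum.remove) auto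
  have "inj_on (\<lambda>c. restrict c ({..<n} - {k})) ?C"
  proof (rule inj_onI)
    fix c c' assume c: "c \<in> ?C" and c': "c' \<in> ?C"
      and eq: "restrict c ({..<n} - {k}) = restrict c' ({..<n} - {k})"
    have off: "c i = c' i" if "i \<noteq> k" for i
    proof (cases "i < n")
      case True
      then show ?thesis using fun_cong[OF eq, of i] that by (simp add: restrict_def)
    next
      case False
      then show ?thesis using c c' by (auto simp: PiE_def extensional_def)
    qed
    then have h: "h c z = h c' z" for z unfolding h_def by (intro sum.cong) auto
    have "[hash c x = hash c y] (mod q)" "[hash c' x = hash c' y] (mod q)" using c c' by auto
    note coll = this[unfolded hash[OF l(1)] hash[OF l(2)] h]
    have cancel: "[c k = c' k] (mod q)" if "[c k + u = v] (mod q)" "[c' k + u = v] (mod q)" for u v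
      using cong_trans[OF that(1) cong_sym[OF that(2)]] by (simp add: cong_add_rcancel_nat)
    from k' coll have "[c k = c' k] (mod q)"
      by (auto intro: cancel cancel[OF cong_sym cong_sym])
    moreover have "c k < q" "c' k < q" using c c' k(1) by auto
    ultimately have "c k = c' k" by (simp add: cong_def)
    with off show "c = c'" by (metis ext)
  qed
  moreover have "(\<lambda>c. restrict c ({..<n} - {k})) ` ?C \<subseteq> PiE ({..<n} - {k}) (\<lambda>_. {..<q})"
    by (intro image_subsetI restrict_PiE_iff[THEN iffD2]) (blast dest: PiE_mem)
  ultimately have "card ?C \<le> card (PiE ({..<n} - {k}) (\<lambda>_. {..<q}))"
    by (intro card_inj_on_le[of _ ?C]) (auto intro!: finite_PiE)
  also have "\<dots> = q ^ (n - 1)" using k(1) by (simp add: card_PiE)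
  finally have "q * card ?C \<le> q * q ^ (n - 1)" by simp
  also have "\<dots> = q ^ n" using k(1) by (cases n) auto
  finally show ?thesis .
qed

text \<open>Averaging over all \<open>q ^ n\<close> vectors: each pair collides for at most a
  fraction \<open>1 / q\<close> of them. The weights allow the choice of one function to take
  earlier choices into account.\<close>

lemma exists_hash_few_collisions:
  fixes wt :: "letter list \<times> letter list \<Rightarrow> nat"
  assumes "q > 0" "finite P" "\<And>p. p \<in> P \<Longrightarrow> fst p \<in> bits n \<and> snd p \<in> bits n \<and> fst p \<noteq> snd p"
  shows "\<exists>c. q * (\<Sum>p\<in>P. if [hash c (fst p) = hash c (snd p)] (mod q) then wt p else 0) \<le> sum wt P"
proof (rule ccontr)
  let ?C = "PiE {..<n} (\<lambda>_. {..<q})"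
  let ?coll = "\<lambda>c p. [hash c (fst p) = hash c (snd p)] (mod q)"
  let ?f = "\<lambda>c. q * (\<Sum>p\<in>P. if ?coll c p then wt p else 0)"
  assume "\<not> ?thesis"
  then have less: "sum wt P < ?f c" for c by (simp add: not_le)
  have fin: "finite ?C" by (intro finite_PiE) auto
  have card: "card ?C = q ^ n" by (simp add: card_PiE)
  have "?C \<noteq> {}" using card assms(1) by auto
  then have "(\<Sum>c\<in>?C. sum wt P) < sum ?f ?C" using fin less by (intro sum_strict_mono) auto
  also have "sum ?f ?C = (\<Sum>p\<in>P. q * (\<Sum>c\<in>?C. if ?coll c p then wt p else 0))"
    unfolding sum_distrib_left[symmetric] by (subst sum.swap) simp
  also have "\<dots> = (\<Sum>p\<in>P. wt p * (q * card {c\<in>?C. ?coll c p}))"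
    using fin by (intro sum.cong refl) (simp add: sum.If_cases Int_def algebra_simps)
  also have "\<dots> \<le> (\<Sum>p\<in>P. wt p * q ^ n)"
    using assms by (intro sum_mono mult_left_mono card_hash_collisions) auto
  also have "\<dots> = (\<Sum>c\<in>?C. sum wt P)" by (simp add: card sum_distrib_right mult.commute)
  finally show False by simp
qed

text \<open>Conditional expectations: each further random hash function multiplies the expectation of
  \<open>q\<close> to the number of collisions by less than \<open>2\<close>.\<close>

lemma exists_hash_family_potential:
  assumes "q > 0" "finite P" "\<And>p. p \<in> P \<Longrightarrow> fst p \<in> bits n \<and> snd p \<in> bits n \<and> fst p \<noteq> snd p"
  shows "\<exists>c. (\<Sum>p\<in>P. q ^ card {j\<in>{..<m}. [hash (c j) (fst p) = hash (c j) (snd p)] (mod q)})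
    \<le> 2 ^ m * card P"
proof (induction m)
  case (Suc m)
  let ?coll = "\<lambda>c p. [hash c (fst p) = hash c (snd p)] (mod q)"
  obtain c where c: "(\<Sum>p\<in>P. q ^ card {j\<in>{..<m}. ?coll (c j) p}) \<le> 2 ^ m * card P"
    using Suc by blast
  define wt where "wt p = q ^ card {j\<in>{..<m}. ?coll (c j) p}" for p
  obtain h where h: "q * (\<Sum>p\<in>P. if ?coll h p then wt p else 0) \<le> sum wt P"
    using exists_hash_few_collisions[of q P n wt, OF assms] by blast
  define c' where "c' = c(m := h)"
  \<comment> \<open>A collision under \<open>h\<close> multiplies the weight by \<open>q\<close>,
    and otherwise the weight is kept; the sum on the right covers both cases. By the choice of
    \<open>h\<close> the second summand totals at most \<open>sum wt P\<close>, so the potential at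
    most doubles.\<close>
  have "q ^ card {j\<in>{..<Suc m}. ?coll (c' j) p} \<le> wt p + q * (if ?coll h p then wt p else 0)" for p
  proof -
    have "{j\<in>{..<Suc m}. ?coll (c' j) p}
        = {j\<in>{..<m}. ?coll (c j) p} \<union> (if ?coll h p then {m} else {})"
      by (auto simp: c'_def less_Suc_eq)
    then show ?thesis by (simp add: wt_def)
  qed
  then have "(\<Sum>p\<in>P. q ^ card {j\<in>{..<Suc m}. ?coll (c' j) p})
      \<le> (\<Sum>p\<in>P. wt p + q * (if ?coll h p then wt p else 0))"
    by (rule sum_mono)
  also have "\<dots> = sum wt P + q * (\<Sum>p\<in>P. if ?coll h p then wt p else 0)"
    by (simp only: sum.distrib sum_distrib_left)
  also have "\<dots> \<le> 2 ^ Suc m * card P" using h c by (simp add: wt_def)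
  finally show ?case by blast
qed simp

text \<open>There are at most \<open>2 ^ (2 * n)\<close> pairs, so the potential after
  \<open>2 * n\<close> rounds is at most \<open>2 ^ (4 * n)\<close>. A pair with \<open>z\<close>
  collisions contributes \<open>64 ^ z = 2 ^ (6 * z)\<close>, hence
  \<open>6 * z \<le> 4 * n\<close>. The modulus \<open>64\<close> and the family size are matched to
  give one third.\<close>

lemma exists_hash_family:
  "\<exists>c. \<forall>x\<in>bits n. \<forall>y\<in>bits n. x \<noteq> y \<longrightarrow>
     3 * card {j\<in>{..<2 * n}. [hash (c j) x = hash (c j) y] (mod 64)} \<le> 2 * n"
proof -
  define P where "P = {p \<in> bits n \<times> bits n. fst p \<noteq> snd p}"
  have fin: "finite P" unfolding P_def
    by (rule finite_subset[of _ "bits n \<times> bits n"]) (auto simp: finite_bits)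
  have "card P \<le> card (bits n \<times> bits n)"
    unfolding P_def using finite_bits by (intro card_mono) auto
  then have card: "card P \<le> 2 ^ (2 * n)"
    by (simp add: card_cartesian_product card_bits mult_2 power_add)
  have "\<exists>c. (\<Sum>p\<in>P. 64 ^ card {j\<in>{..<2 * n}. [hash (c j) (fst p) = hash (c j) (snd p)] (mod 64)})
      \<le> 2 ^ (2 * n) * card P"
    by (rule exists_hash_family_potential) (use fin in \<open>auto simp: P_def\<close>)
  then obtain c where c: "(\<Sum>p\<in>P. 64 ^ card {j\<in>{..<2 * n}. [hash (c j) (fst p) = hash (c j) (snd p)] (mod 64)})
      \<le> 2 ^ (2 * n) * card P" by blast
  have "3 * card {j\<in>{..<2 * n}. [hash (c j) x = hash (c j) y] (mod 64)} \<le> 2 * n"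
    if xy: "x \<in> bits n" "y \<in> bits n" "x \<noteq> y" for x y
  proof -
    let ?z = "\<lambda>p. card {j\<in>{..<2 * n}. [hash (c j) (fst p) = hash (c j) (snd p)] (mod 64)}"
    have "(2::nat) ^ (6 * ?z (x, y)) = 64 ^ ?z (x, y)" by (simp add: power_mult)
    also have "\<dots> \<le> (\<Sum>p\<in>P. 64 ^ ?z p)"
      using xy fin by (intro member_le_sum) (auto simp: P_def)
    also have "\<dots> \<le> 2 ^ (2 * n) * 2 ^ (2 * n)" using c card by (meson le_trans mult_le_mono2)
    also have "\<dots> = 2 ^ (4 * n)" by (simp flip: power_add)
    finally have "6 * ?z (x, y) \<le> 4 * n" by simp
    then show ?thesis by simp
  qed
  then show ?thesis by blast
qed

section \<open>One-pass automata\<close>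

primrec scan :: "(nat \<Rightarrow> 'a \<Rightarrow> nat \<Rightarrow> nat option) \<Rightarrow> 'a list \<Rightarrow> nat \<Rightarrow> nat option" where
  "scan d w 0 = Some 0"
| "scan d w (Suc t) = Option.bind (scan d w t) (d t (w ! t))"

lemma scan_None_mono: "scan d w t = None \<Longrightarrow> t \<le> u \<Longrightarrow> scan d w u = None"
  by (rotate_tac, induction u rule: dec_induct) auto

text \<open>In \<open>Run k i r\<close>, \<open>k\<close> is the random choice, \<open>i\<close> the number of letters read and \<open>r\<close> the register.\<close>

datatype scan_state = Init | Acc | Rej | Run nat nat nat

instance scan_state :: countable
  by countable_datatype

text \<open>A letter read after \<open>l\<close> letters leads to rejection at once, which bounds
  the time on words of every length.\<close>

fun scan_move :: "(nat \<Rightarrow> nat \<Rightarrow> 'a \<Rightarrow> nat \<Rightarrow> nat option) \<Rightarrow> nat \<Rightarrow> nat \<Rightarrow> scan_state \<Rightarrow> 'a tape_sym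
    \<Rightarrow> scan_state \<times> int" where
  "scan_move d l j Init LEnd = (Run j 0 0, 1)"
| "scan_move d l j (Run k i r) (Sym a) =
    (if i < l then (case d k i a r of None \<Rightarrow> (Rej, 0) | Some r' \<Rightarrow> (Run k (Suc i) r', 1)) else (Rej, 0))"
| "scan_move d l j (Run k i r) REnd = (if i = l \<and> r = 0 then Acc else Rej, 0)"
| "scan_move d l j _ _ = (Rej, 0)"

definition scan_states :: "nat \<Rightarrow> nat \<Rightarrow> nat \<Rightarrow> scan_state set" where
  "scan_states l J R = {Init, Acc, Rej} \<union> (\<lambda>(k, i, r). Run k i r) ` ({..<J} \<times> {..l} \<times> {..<R})"

lemma mem_scan_states [simp]:
  "Init \<in> scan_states l J R" "Acc \<in> scan_states l J R" "Rej \<in> scan_states l J R"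
  "Run k i r \<in> scan_states l J R \<longleftrightarrow> k < J \<and> i \<le> l \<and> r < R"
  by (auto simp: scan_states_def image_iff)

lemma finite_scan_states: "finite (scan_states l J R)"
  by (simp add: scan_states_def)

lemma card_scan_states: "card (scan_states l J R) \<le> 3 + J * Suc l * R"
proof -
  have "card (scan_states l J R) \<le> card {Init, Acc, Rej}
      + card ((\<lambda>(k, i, r). Run k i r) ` ({..<J} \<times> {..l} \<times> {..<R}))"
    unfolding scan_states_def by (rule card_Un_le)
  also have "\<dots> \<le> 3 + card ({..<J} \<times> {..l} \<times> {..<R})"
    by (intro add_mono card_image_le) auto
  finally show ?thesis by (simp add: card_cartesian_product algebra_simps)
qed

text \<open>The index \<open>j\<close> is drawn afresh in every step, but only the step from \<open>Init\<close> uses it.\<close>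

definition scan_pfa ::
    "(nat \<Rightarrow> nat \<Rightarrow> 'a \<Rightarrow> nat \<Rightarrow> nat option) \<Rightarrow> nat \<Rightarrow> nat \<Rightarrow> nat \<Rightarrow> (nat, 'a) pfa2" where
  "scan_pfa d l J R = \<lparr>states = to_nat ` scan_states l J R, start = to_nat Init,
     acc = {to_nat Acc}, rej = {to_nat Rej},
     ptrans = (\<lambda>s a. map_pmf (\<lambda>j. map_prod to_nat id (scan_move d l j (from_nat s) a))
       (pmf_of_set {..<J}))\<rparr>"

lemma scan_pfa_simps [simp]:
  "states (scan_pfa d l J R) = to_nat ` scan_states l J R"
  "start (scan_pfa d l J R) = to_nat Init"
  "acc (scan_pfa d l J R) = {to_nat Acc}" "rej (scan_pfa d l J R) = {to_nat Rej}"
  "ptrans (scan_pfa d l J R) s a = map_pmf (\<lambda>j. map_prod to_nat id (scan_move d l j (from_nat s) a))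
       (pmf_of_set {..<J})"
  by (simp_all add: scan_pfa_def)

lemma scan_move_legal:
  assumes "s \<in> scan_states l J R" "j < J" "R > 0"
    and "\<And>k i a r r'. d k i a r = Some r' \<Longrightarrow> r' < R"
  shows "fst (scan_move d l j s a) \<in> scan_states l J R"
    and "snd (scan_move d l j s a) \<in> {0, 1}" "a = REnd \<Longrightarrow> snd (scan_move d l j s a) = 0"
  using assms
  by (induction d l j s a rule: scan_move.induct) (auto split: option.splits)

lemma wf_scan_pfa:
  assumes "J > 0" "R > 0" "\<And>k i a r r'. d k i a r = Some r' \<Longrightarrow> r' < R"
  shows "wf_pfa2 (scan_pfa d l J R)"
proof -
  have set: "set_pmf (pmf_of_set {..<J}) = {..<J}" using assms(1) by (intro set_pmf_of_set) auto
  have "map_prod to_nat id (scan_move d l j s a) \<in> legal_moves (scan_pfa d l J R) a"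
    if "s \<in> scan_states l J R" "j < J" for s j a
    using scan_move_legal[where d = d and a = a and l = l, OF that assms(2,3)]
    by (cases "scan_move d l j s a") (auto simp: legal_moves_def)
  moreover have "wf_control (scan_pfa d l J R)"
    by (auto simp: wf_control_def finite_scan_states)
  ultimately show ?thesis by (auto simp: wf_pfa2_def set)
qed

text \<open>The semantics for a fixed index \<open>j\<close>; the automaton runs as the uniform
  mixture of these.\<close>

definition scan_step :: "(nat \<Rightarrow> nat \<Rightarrow> 'a \<Rightarrow> nat \<Rightarrow> nat option) \<Rightarrow> nat \<Rightarrow> 'a list \<Rightarrow> nat
    \<Rightarrow> scan_state config \<Rightarrow> scan_state config" where
  "scan_step d l w j c = (if fst c \<in> {Acc, Rej} then c
     else apply_move (snd c) (scan_move d l j (fst c) (tape w (snd c))))"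

definition scan_run :: "(nat \<Rightarrow> nat \<Rightarrow> 'a \<Rightarrow> nat \<Rightarrow> nat option) \<Rightarrow> nat \<Rightarrow> 'a list \<Rightarrow> nat \<Rightarrow> nat
    \<Rightarrow> scan_state config" where
  "scan_run d l w j t = (scan_step d l w j ^^ t) (Init, 0)"

lemma scan_run_0: "scan_run d l w j 0 = (Init, 0)"
  and scan_run_Suc: "scan_run d l w j (Suc t) = scan_step d l w j (scan_run d l w j t)"
  by (simp_all add: scan_run_def)

lemma scan_step_not_Init: "fst (scan_step d l w j c) \<noteq> Init"
proof -
  have "fst (scan_move d l j s a) \<noteq> Init" for s and a
    by (induction d l j s a rule: scan_move.induct) (auto split: option.splits)
  then show ?thesis by (auto simp: scan_step_def apply_move_def)
qed

lemma scan_move_choice: "s \<noteq> Init \<Longrightarrow> scan_move d l j s a = scan_move d l k s a"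
  by (cases s; cases a) auto

lemma pfa2_step_scan_pfa:
  "pfa2_step (scan_pfa d l J R) w (map_prod to_nat id c)
    = map_pmf (\<lambda>j. map_prod to_nat id (scan_step d l w j c)) (pmf_of_set {..<J})"
  by (cases c)
    (auto simp: pfa2_step_def halting_def scan_step_def apply_move_def pmf.map_comp o_def
      intro!: map_pmf_cong)

text \<open>The first step stores the index in the state and later moves ignore what is drawn, so a
  single \<open>j\<close> governs the whole run.\<close>

lemma pfa2_run_scan_pfa:
  "pfa2_run (scan_pfa d l J R) w t
    = map_pmf (\<lambda>j. map_prod to_nat id (scan_run d l w j t)) (pmf_of_set {..<J})"
proof (induction t)
  case 0
  then show ?case by (simp add: scan_run_0)
next
  case (Suc t)
  have "pfa2_run (scan_pfa d l J R) w (Suc t) = bind_pmf (pmf_of_set {..<J})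
      (\<lambda>j. pfa2_step (scan_pfa d l J R) w (map_prod to_nat id (scan_run d l w j t)))"
    unfolding pfa2_run.simps Suc bind_map_pmf ..
  also have "\<dots> = map_pmf (\<lambda>j. map_prod to_nat id (scan_run d l w j (Suc t))) (pmf_of_set {..<J})"
  proof (cases t)
    case 0
    then show ?thesis unfolding pfa2_step_scan_pfa by (simp add: scan_run_0 scan_run_Suc)
  next
    case (Suc u)
    then have "fst (scan_run d l w j t) \<noteq> Init" for j
      by (simp add: scan_run_Suc scan_step_not_Init)
    then have eq: "scan_step d l w k (scan_run d l w j t) = scan_run d l w j (Suc t)" for j k
      unfolding scan_run_Suc using scan_move_choice by (metis scan_step_def)
    then have "pfa2_step (scan_pfa d l J R) w (map_prod to_nat id (scan_run d l w j t))
        = return_pmf (map_prod to_nat id (scan_run d l w j (Suc t)))" for j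
      unfolding pfa2_step_scan_pfa eq by simp
    then show ?thesis by (simp add: map_pmf_def)
  qed
  finally show ?case .
qed

text \<open>The shift by one is the step off the left endmarker. \<open>A\<close> is the intended
  verdict, with which every halting state must agree.\<close>

lemma scan_run_invariant:
  assumes "A \<longleftrightarrow> length w = l \<and> scan (d j) w l = Some 0"
  shows "fst (scan_run d l w j (Suc t)) = Rej \<and> \<not> A \<or> fst (scan_run d l w j (Suc t)) = Acc \<and> A \<or>
    (\<exists>r. scan (d j) w t = Some r \<and> scan_run d l w j (Suc t) = (Run j t r, Suc t)
      \<and> t \<le> length w \<and> t \<le> l)"
proof (induction t)
  case 0
  then show ?case by (simp add: scan_run_Suc scan_run_0 scan_step_def tape_def apply_move_def)
next
  case (Suc t)
  let ?c = "scan_run d l w j (Suc t)"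
  consider "fst ?c = Rej \<and> \<not> A \<or> fst ?c = Acc \<and> A"
    | r where "scan (d j) w t = Some r" "?c = (Run j t r, Suc t)" "t \<le> length w" "t \<le> l"
    using Suc by blast
  then show ?case
  proof cases
    case 1
    then have "scan_run d l w j (Suc (Suc t)) = ?c"
      by (subst scan_run_Suc) (auto simp: scan_step_def)
    with 1 show ?thesis by auto
  next
    case (2 r)
    have step: "scan_run d l w j (Suc (Suc t))
        = apply_move (Suc t) (scan_move d l j (Run j t r) (tape w (Suc t)))"
      by (subst scan_run_Suc) (simp add: 2(2) scan_step_def)
    consider "t = length w" | "t < length w" "t = l" | "t < length w" "t < l" "d j t (w ! t) r = None"
      | r' where "t < length w" "t < l" "d j t (w ! t) r = Some r'"
      using 2(3,4) by fastforce
    then show ?thesis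
    proof cases
      case 1
      then show ?thesis unfolding step using 2(1) assms by (auto simp: tape_def apply_move_def)
    next
      case 2
      then show ?thesis unfolding step using assms by (simp add: tape_def apply_move_def)
    next
      case 3
      then have "scan (d j) w l = None"
        using 2(1) by (intro scan_None_mono[of "d j" w "Suc t" l]) auto
      then show ?thesis unfolding step using 3 assms by (simp add: tape_def apply_move_def)
    next
      case 4
      then show ?thesis unfolding step using 2(1) by (simp add: tape_def apply_move_def)
    qed
  qed
qed

text \<open>One step for each endmarker and one for each of \<open>l\<close> letters: at
  \<open>t = Suc l\<close> the running alternative of the invariant would require
  \<open>t \<le> l\<close>.\<close>

lemma scan_run_final:
  "fst (scan_run d l w j (Suc (Suc l)))
    = (if length w = l \<and> scan (d j) w l = Some 0 then Acc else Rej)"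
  using scan_run_invariant[of "length w = l \<and> scan (d j) w l = Some 0" w l d j "Suc l"] by auto

lemma scan_pfa_halts: "J > 0 \<Longrightarrow> halts_within (scan_pfa d l J R) w (Suc (Suc l)) (to_nat Init, 0)"
  using pfa2_run_eq_iter[of "scan_pfa d l J R" w "Suc (Suc l)", symmetric] scan_run_final[of d l w]
  by (auto simp: halts_within_def pfa2_run_scan_pfa halting_def
      simp del: iter_pmf.simps pfa2_run.simps)

lemma pfa2_accept_prob_scan_pfa:
  assumes "J > 0"
  shows "pfa2_accept_prob (scan_pfa d l J R) w
    = real (card {j\<in>{..<J}. length w = l \<and> scan (d j) w l = Some 0}) / real J"
proof -
  let ?M = "scan_pfa d l J R"
  have "outcome ?M w (Suc (Suc l)) (start ?M, 0)
      = map_pmf (\<lambda>j. to_nat (fst (scan_run d l w j (Suc (Suc l))))) (pmf_of_set {..<J})"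
    unfolding outcome_def pfa2_run_eq_iter[symmetric] pfa2_run_scan_pfa
    by (simp add: pmf.map_comp o_def)
  moreover have "pfa2_accept_prob ?M w = measure_pmf.prob (outcome ?M w (Suc (Suc l)) (start ?M, 0)) {to_nat Acc}"
    using pfa2_accept_prob_outcome[of ?M w "Suc (Suc l)"] scan_pfa_halts[OF assms, of d l R w] by simp
  ultimately have "pfa2_accept_prob ?M w = measure_pmf.prob (pmf_of_set {..<J})
      {j. length w = l \<and> scan (d j) w l = Some 0}"
    by (simp add: scan_run_final vimage_def if_distrib)
  then show ?thesis using assms by (subst (asm) measure_pmf_of_set) (auto simp: Int_def)
qed

lemma log2_add_nonneg: "0 \<le> log 2 (real (3 + k))"
proof -
  have "log 2 1 \<le> log 2 (real (3 + k))" by (intro log_mono) auto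
  then show ?thesis by simp
qed

lemma pfa2_TS_scan_pfa_le:
  assumes "J > 0"
  shows "pfa2_TS (scan_pfa d l J R) \<le> ennreal (real (Suc (Suc l)) * log 2 (real (3 + J * Suc l * R)))"
proof -
  let ?M = "scan_pfa d l J R"
  have "pfa2_steps ?M w \<le> enat (Suc (Suc l))" for w
    unfolding pfa2_steps_def using scan_pfa_halts[OF assms, of d l R w]
    by (intro INF_lower) (simp add: halts_within_def pfa2_run_eq_iter)
  then have "pfa2_time ?M \<le> enat (Suc (Suc l))" unfolding pfa2_time_def by (rule SUP_least)
  then have "ennreal_of_enat (pfa2_time ?M) \<le> ennreal (real (Suc (Suc l)))"
    by (metis ennreal_of_enat_enat ennreal_of_enat_le_iff ennreal_of_nat_eq_real_of_nat)
  moreover have "card (scan_states l J R) > 0"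
    using finite_scan_states by (auto simp: card_gt_0_iff scan_states_def)
  then have "space_of ?M \<le> log 2 (real (3 + J * Suc l * R))"
    using card_scan_states[of l J R] unfolding space_of_def
    by (intro log_mono) (auto simp: card_image simp flip: of_nat_add of_nat_mult)
  ultimately have "pfa2_TS ?M \<le> ennreal (real (Suc (Suc l))) * ennreal (log 2 (real (3 + J * Suc l * R)))"
    unfolding pfa2_TS_def by (intro mult_mono ennreal_leI) auto
  also have "\<dots> = ennreal (real (Suc (Suc l)) * log 2 (real (3 + J * Suc l * R)))"
    by (intro ennreal_mult[symmetric] log2_add_nonneg) simp
  finally show ?thesis .
qed

section \<open>The automaton comparing the hashes of the two halves\<close>

text \<open>The register accumulates the hash of the left word minus that of the right word modulo \<open>q\<close>;
  the factor \<open>q - 1\<close> plays the role of \<open>-1\<close>.\<close>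

definition eq_weight :: "nat \<Rightarrow> nat \<Rightarrow> (nat \<Rightarrow> nat) \<Rightarrow> nat \<Rightarrow> letter \<Rightarrow> nat" where
  "eq_weight n q c i a =
     (if a = One then if i < n then c i else (q - 1) * c (i - 2 * n) else 0)"

definition eq_delta :: "nat \<Rightarrow> nat \<Rightarrow> (nat \<Rightarrow> nat) \<Rightarrow> nat \<Rightarrow> letter \<Rightarrow> nat \<Rightarrow> nat option" where
  "eq_delta n q c i a r = (if a = Hash \<longleftrightarrow> n \<le> i \<and> i < 2 * n
     then Some ((r + eq_weight n q c i a) mod q) else None)"

lemma scan_eq_delta:
  assumes "q > 0"
  shows "scan (eq_delta n q c) w t = (if (\<forall>i<t. w ! i = Hash \<longleftrightarrow> n \<le> i \<and> i < 2 * n)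
    then Some ((\<Sum>i<t. eq_weight n q c i (w ! i)) mod q) else None)"
proof (induction t)
  case (Suc t)
  then show ?case by (auto simp: eq_delta_def less_Suc_eq mod_simps)
qed simp

lemma format_iff:
  "length w = 3 * n \<and> (\<forall>i<3 * n. w ! i = Hash \<longleftrightarrow> n \<le> i \<and> i < 2 * n)
    \<longleftrightarrow> (\<exists>x\<in>bits n. \<exists>y\<in>bits n. w = separated n x y)" (is "?L \<longleftrightarrow> ?R")
proof
  assume L: ?L
  have a: "a = Zero \<or> a = One" if "a \<noteq> Hash" for a using that by (cases a) auto
  have "w ! i = One" if "w ! i \<noteq> Zero" "i < n" for i
    using a[of "w ! i"] L that by auto
  moreover have "w ! (2 * n + i) = One" if "w ! (2 * n + i) \<noteq> Zero" "i < n" for i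
    using a[of "w ! (2 * n + i)"] L that by auto
  ultimately have "take n w \<in> bits n" "drop (2 * n) w \<in> bits n"
    using L by (auto simp: bits_def in_set_conv_nth)
  moreover have "w = separated n (take n w) (drop (2 * n) w)"
    using L by (intro nth_equalityI) (auto simp: nth_append)
  ultimately show ?R by blast
next
  assume ?R
  then obtain x y where xy: "x \<in> bits n" "y \<in> bits n" "w = separated n x y" by blast
  have "z ! i \<noteq> Hash" if "z \<in> bits n" "i < n" for z i
    using bits_nth[OF that] by auto
  then show ?L using xy by (auto simp: nth_append) (auto simp: bits_def)
qed

lemma sum_separated:
  assumes "x \<in> bits n" "y \<in> bits n"
  shows "(\<Sum>i<3 * n. eq_weight n q c i (separated n x y ! i)) = hash c x + (q - 1) * hash c y" (is "sum ?f _ = _")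
proof -
  have l: "length x = n" "length y = n" using assms by (auto simp: bits_def)
  have "sum ?f {..<3 * n} = sum ?f {0..<n} + sum ?f {n..<2 * n} + sum ?f {2 * n..<3 * n}"
    by (simp add: sum.atLeastLessThan_concat lessThan_atLeast0)
  also have "sum ?f {0..<n} = hash c x"
    by (auto simp: hash_def l nth_append lessThan_atLeast0 eq_weight_def intro!: sum.cong)
  also have "sum ?f {n..<2 * n} = 0"
    by (intro sum.neutral) (auto simp: nth_append l eq_weight_def)
  also have "sum ?f {2 * n..<3 * n} = (\<Sum>i\<in>{0..<n}. ?f (i + 2 * n))"
    using sum.shift_bounds_nat_ivl[of ?f 0 "2 * n" n] by simp
  also have "\<dots> = (q - 1) * hash c y"
    by (auto simp: hash_def l nth_append lessThan_atLeast0 sum_distrib_left eq_weight_def intro!: sum.cong)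
  finally show ?thesis by simp
qed

lemma scan_eq_delta_accepts:
  assumes "q > 0"
  shows "length w = 3 * n \<and> scan (eq_delta n q c) w (3 * n) = Some 0
    \<longleftrightarrow> (\<exists>x\<in>bits n. \<exists>y\<in>bits n. w = separated n x y \<and> [hash c x = hash c y] (mod q))"
proof -
  have *: "(u + (q - 1) * v) mod q = 0 \<longleftrightarrow> [u = v] (mod q)" for u v
  proof -
    \<comment> \<open>Adding \<open>v\<close> on both sides of the congruence turns the coefficient
      \<open>q - 1\<close> into \<open>q\<close>, which vanishes modulo \<open>q\<close>.\<close>
    have "u + (q - 1) * v + v = u + q * v" using assms by (cases q) auto
    then have "[u + (q - 1) * v = 0] (mod q) \<longleftrightarrow> [u + q * v = 0 + v] (mod q)"
      by (metis cong_add_rcancel_nat)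
    then show ?thesis by (simp add: cong_def)
  qed
  show ?thesis
  proof (cases "\<exists>x\<in>bits n. \<exists>y\<in>bits n. w = separated n x y")
    case True
    then obtain x y where xy: "x \<in> bits n" "y \<in> bits n" and w: "w = separated n x y" by blast
    have L: "length w = 3 * n \<and> scan (eq_delta n q c) w (3 * n)
        = Some ((hash c x + (q - 1) * hash c y) mod q)"
      using format_iff[of w n] True sum_separated[OF xy] by (simp add: scan_eq_delta[OF assms] w)
    have "x' = x \<and> y' = y" if "x' \<in> bits n" "y' \<in> bits n" "w = separated n x' y'" for x' y'
      using that xy by (auto simp: w bits_def)
    with xy w have "(\<exists>x\<in>bits n. \<exists>y\<in>bits n. w = separated n x y \<and> [hash c x = hash c y] (mod q))
        \<longleftrightarrow> [hash c x = hash c y] (mod q)" by blast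
    then show ?thesis by (simp only: L option.inject *) simp
  next
    case False
    then have "\<not> (length w = 3 * n \<and> (\<forall>i<3 * n. w ! i = Hash \<longleftrightarrow> n \<le> i \<and> i < 2 * n))"
      using format_iff[of w n] by simp
    then have "\<not> (length w = 3 * n \<and> scan (eq_delta n q c) w (3 * n) = Some 0)"
      by (auto simp: scan_eq_delta[OF assms])
    then show ?thesis using False by blast
  qed
qed

text \<open>With coefficients \<open>2 ^ i\<close> the hash is the binary value of the word, here
  \<open>set_encode\<close> of the positions of its ones. It lies below \<open>2 ^ n\<close>, so
  congruence is equality.\<close>

lemma hash_binary_inj:
  assumes "x \<in> bits n" "y \<in> bits n" "[hash (\<lambda>i. 2 ^ i) x = hash (\<lambda>i. 2 ^ i) y] (mod 2 ^ n)"
  shows "x = y"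
proof -
  let ?S = "\<lambda>x. {i\<in>{..<n}. x ! i = One}"
  have hash: "hash (\<lambda>i. 2 ^ i) x = set_encode (?S x)" if "x \<in> bits n" for x
    unfolding hash_def set_encode_def using that by (subst sum.inter_filter) (auto simp: bits_def)
  have less: "set_encode (?S x) < 2 ^ n" for x
  proof -
    have "set_encode (?S x) \<le> (\<Sum>i<n. 2 ^ i)"
      unfolding set_encode_def by (intro sum_mono2) auto
    also have "\<dots> < 2 ^ n" by (simp add: mask_eq_sum_exp[symmetric] sum_power2 lessThan_atLeast0)
    finally show ?thesis .
  qed
  have "set_encode (?S x) = set_encode (?S y)"
    using assms less by (simp add: hash cong_def)
  then have *: "?S x = ?S y" using inj_on_set_encode by (auto simp: inj_on_def)
  have "x ! i = y ! i" if "i < n" for i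
  proof -
    have "x ! i = One \<longleftrightarrow> y ! i = One" using * that by blast
    then show ?thesis using bits_nth[OF assms(1) that] bits_nth[OF assms(2) that] by auto
  qed
  then show ?thesis using assms(1,2) by (intro nth_equalityI) (auto simp: bits_def)
qed

section \<open>Upper bounds\<close>

lemma eq_delta_less: "q > 0 \<Longrightarrow> eq_delta n q c i a r = Some r' \<Longrightarrow> r' < q"
  by (auto simp: eq_delta_def split: if_splits)

lemma pfa2_accept_prob_eq_automaton:
  assumes "J > 0" "q > 0"
  shows "pfa2_accept_prob (scan_pfa (\<lambda>j. eq_delta n q (c j)) (3 * n) J q) w
    = real (card {j\<in>{..<J}. \<exists>x\<in>bits n. \<exists>y\<in>bits n. w = separated n x y
        \<and> [hash (c j) x = hash (c j) y] (mod q)}) / real J"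
  using assms by (simp add: pfa2_accept_prob_scan_pfa scan_eq_delta_accepts)

lemma pfa2_accept_prob_eq_automaton_mem:
  assumes "J > 0" "q > 0" "w \<in> L_EQ n"
  shows "pfa2_accept_prob (scan_pfa (\<lambda>j. eq_delta n q (c j)) (3 * n) J q) w = 1"
proof -
  obtain x where "x \<in> bits n" "w = separated n x x" using assms(3) by (auto simp: L_EQ_alt)
  then have "{j\<in>{..<J}. \<exists>x\<in>bits n. \<exists>y\<in>bits n. w = separated n x y
        \<and> [hash (c j) x = hash (c j) y] (mod q)} = {..<J}"
    by (auto intro!: bexI[of _ x])
  then show ?thesis using assms(1) by (simp add: pfa2_accept_prob_eq_automaton[OF assms(1,2)])
qed

text \<open>A malformed word is rejected for every index. A well-formed one splits uniquely into its
  halves, so it is accepted exactly for the indices at which these collide.\<close>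

lemma pfa2_accept_prob_eq_automaton_not_mem:
  assumes "J > 0" "q > 0" "w \<notin> L_EQ n" "b \<ge> 0"
    and coll: "\<And>x y. x \<in> bits n \<Longrightarrow> y \<in> bits n \<Longrightarrow> x \<noteq> y \<Longrightarrow>
      real (card {j\<in>{..<J}. [hash (c j) x = hash (c j) y] (mod q)}) \<le> b * real J"
  shows "pfa2_accept_prob (scan_pfa (\<lambda>j. eq_delta n q (c j)) (3 * n) J q) w \<le> b"
proof (cases "\<exists>x\<in>bits n. \<exists>y\<in>bits n. w = separated n x y")
  case True
  then obtain x y where xy: "x \<in> bits n" "y \<in> bits n" "w = separated n x y" by blast
  then have "x \<noteq> y" using assms(3) by (auto simp: L_EQ_alt)
  moreover have "x' = x \<and> y' = y" if "x' \<in> bits n" "y' \<in> bits n" "w = separated n x' y'" for x' y'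
    using that xy by (auto simp: bits_def)
  with xy have "{j\<in>{..<J}. \<exists>x\<in>bits n. \<exists>y\<in>bits n. w = separated n x y
        \<and> [hash (c j) x = hash (c j) y] (mod q)} = {j\<in>{..<J}. [hash (c j) x = hash (c j) y] (mod q)}"
    by blast
  ultimately show ?thesis
    unfolding pfa2_accept_prob_eq_automaton[OF assms(1,2)]
    using coll[OF xy(1,2)] assms(1) by (simp add: divide_le_eq)
next
  case False
  then have "{j\<in>{..<J}. \<exists>x\<in>bits n. \<exists>y\<in>bits n. w = separated n x y
        \<and> [hash (c j) x = hash (c j) y] (mod q)} = {}" by blast
  from arg_cong[where f = card, OF this] show ?thesis
    unfolding pfa2_accept_prob_eq_automaton[OF assms(1,2)] using assms(4) by (simp only:) simp
qed

text \<open>The case of a single index, where the uniform draw is a point mass.\<close>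

definition scan_dfa :: "(nat \<Rightarrow> nat \<Rightarrow> 'a \<Rightarrow> nat \<Rightarrow> nat option) \<Rightarrow> nat \<Rightarrow> nat \<Rightarrow> (nat, 'a) dfa2" where
  "scan_dfa d l R = \<lparr>states = to_nat ` scan_states l 1 R, start = to_nat Init,
     acc = {to_nat Acc}, rej = {to_nat Rej},
     dtrans = (\<lambda>s a. map_prod to_nat id (scan_move d l 0 (from_nat s) a))\<rparr>"

lemma pfa_of_scan_dfa: "pfa_of_dfa (scan_dfa d l R) = scan_pfa d l 1 R"
  by (simp add: pfa_of_dfa_def scan_dfa_def scan_pfa_def lessThan_Suc pmf_of_set_singleton)

lemma TS_2DFA_L_EQ_le: "TS_2DFA (L_EQ n) \<le> ennreal (real (3 * n + 2) * real (4 * n + 4))"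
proof -
  let ?q = "2 ^ n" and ?c = "\<lambda>_ i. 2 ^ i :: nat"
  let ?d = "\<lambda>j. eq_delta n ?q (?c j)"
  let ?M = "scan_dfa ?d (3 * n) ?q"
  have wf: "wf_pfa2 (scan_pfa ?d (3 * n) 1 ?q)"
    by (rule wf_scan_pfa) (auto dest: eq_delta_less[rotated])
  have prob: "pfa2_accept_prob (pfa_of_dfa ?M) w = of_bool (w \<in> L_EQ n)" for w
  proof (cases "w \<in> L_EQ n")
    case True
    then show ?thesis unfolding pfa_of_scan_dfa
      by (simp add: pfa2_accept_prob_eq_automaton_mem del: One_nat_def)
  next
    case False
    \<comment> \<open>Distinct words never collide under the binary hash, so the collision bound
      holds with \<open>b = 0\<close>.\<close>
    have "pfa2_accept_prob (pfa_of_dfa ?M) w \<le> 0" unfolding pfa_of_scan_dfa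
      using False hash_binary_inj
      by (intro pfa2_accept_prob_eq_automaton_not_mem) (auto simp: card_eq_0_iff)
    then show ?thesis using False by (simp add: of_bool_def split: if_splits)
  qed
  have "dfa2_accepts ?M w \<longleftrightarrow> w \<in> L_EQ n" for w
    using prob[of w] by (simp add: of_bool_def split: if_splits)
  moreover have "wf_dfa2 ?M" using wf unfolding pfa_of_scan_dfa[symmetric] by simp
  ultimately have "dfa2_recognizes ?M (L_EQ n)" by (simp add: dfa2_recognizes_def)
  then have "TS_2DFA (L_EQ n) \<le> dfa2_TS ?M" unfolding TS_2DFA_def by (intro INF_lower) simp
  also have "\<dots> = pfa2_TS (scan_pfa ?d (3 * n) 1 ?q)"
    using pfa2_TS_pfa_of_dfa[of ?M] unfolding pfa_of_scan_dfa by simp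
  also have "\<dots> \<le> ennreal (real (Suc (Suc (3 * n))) * log 2 (real (3 + 1 * Suc (3 * n) * ?q)))"
    by (rule pfa2_TS_scan_pfa_le) simp
  also have "\<dots> \<le> ennreal (real (3 * n + 2) * real (4 * n + 4))"
  proof (intro ennreal_leI mult_mono)
    \<comment> \<open>The register modulo \<open>2 ^ n\<close> dominates: the number of states is at
      most \<open>2 ^ (4 * n + 4)\<close>, so the space is linear.\<close>
    have "3 + 1 * Suc (3 * n) * 2 ^ n \<le> (3 * n + 4) * (2 ^ n :: nat)" by (simp add: algebra_simps)
    also have "\<dots> \<le> 2 ^ (3 * n + 4) * 2 ^ n" by (intro mult_right_mono less_imp_le less_exp) auto
    also have "\<dots> = 2 ^ (4 * n + 4)" by (simp flip: power_add)
    finally have "real (3 + 1 * Suc (3 * n) * 2 ^ n) \<le> real (2 ^ (4 * n + 4))" by (rule of_nat_mono)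
    then have "log 2 (real (3 + 1 * Suc (3 * n) * 2 ^ n)) \<le> log 2 (real (2 ^ (4 * n + 4)))"
      by (intro log_mono) (auto intro: add_pos_nonneg)
    also have "\<dots> = real (4 * n + 4)" by (simp only: of_nat_power of_nat_numeral log_pow_cancel)
    finally show "log 2 (real (3 + 1 * Suc (3 * n) * 2 ^ n)) \<le> real (4 * n + 4)" .
    show "0 \<le> log 2 (real (3 + 1 * Suc (3 * n) * 2 ^ n))" by (rule log2_add_nonneg)
  qed auto
  finally show ?thesis .
qed

lemma TS_2PFA_L_EQ_le:
  assumes "n \<ge> 64"
  shows "TS_2PFA (L_EQ n) \<le> ennreal (20 * (real n * log 2 (real n)))"
proof -
  obtain c where c: "\<And>x y. x \<in> bits n \<Longrightarrow> y \<in> bits n \<Longrightarrow> x \<noteq> y \<Longrightarrow>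
     3 * card {j\<in>{..<2 * n}. [hash (c j) x = hash (c j) y] (mod 64)} \<le> 2 * n"
    using exists_hash_family[of n] by blast
  let ?d = "\<lambda>j. eq_delta n 64 (c j)"
  let ?M = "scan_pfa ?d (3 * n) (2 * n) 64"
  have pos: "2 * n > 0" using assms by simp
  have "wf_pfa2 ?M"
    using pos by (intro wf_scan_pfa) (auto dest: eq_delta_less[rotated])
  moreover have "pfa2_accept_prob ?M w \<ge> 1 - 1/3" if "w \<in> L_EQ n" for w
    using pfa2_accept_prob_eq_automaton_mem[OF pos _ that, of 64 c] by simp
  moreover have "pfa2_accept_prob ?M w \<le> 1/3" if "w \<notin> L_EQ n" for w
  proof (rule pfa2_accept_prob_eq_automaton_not_mem[OF pos _ that])
    fix x y assume "x \<in> bits n" "y \<in> bits n" "x \<noteq> y"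
    from of_nat_mono[OF c[OF this], where 'a = real]
    show "real (card {j\<in>{..<2 * n}. [hash (c j) x = hash (c j) y] (mod 64)}) \<le> 1/3 * real (2 * n)"
      by simp
  qed auto
  ultimately have "pfa2_recognizes (1/3) ?M (L_EQ n)" by (simp add: pfa2_recognizes_def)
  then have "TS_2PFA (L_EQ n) \<le> pfa2_TS ?M"
    unfolding TS_2PFA_def by (intro INF_lower) (auto intro!: exI[of _ "1/3"])
  also have "\<dots> \<le> ennreal (real (Suc (Suc (3 * n))) * log 2 (real (3 + 2 * n * Suc (3 * n) * 64)))"
    by (rule pfa2_TS_scan_pfa_le[OF pos])
  also have "\<dots> \<le> ennreal ((5 * real n) * (4 * log 2 (real n)))"
  proof (intro ennreal_leI mult_mono)
    \<comment> \<open>The states combine \<open>2 * n\<close> indices, \<open>3 * n + 1\<close>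
      positions and \<open>64\<close> residues. Their number is at most \<open>515 * n ^ 2\<close>,
      and \<open>515 \<le> 64 * 64 \<le> n ^ 2\<close>, which gives \<open>n ^ 4\<close>.\<close>
    have "3 + 2 * n * Suc (3 * n) * 64 = 3 + 128 * n + 384 * n ^ 2"
      by (simp add: algebra_simps power2_eq_square)
    also have "\<dots> \<le> 3 * n ^ 2 + 128 * n ^ 2 + 384 * n ^ 2"
      using assms by (intro add_mono) (auto simp: power2_eq_square)
    also have "\<dots> \<le> (64 * 64) * n ^ 2" by simp
    also have "\<dots> \<le> (n * n) * n ^ 2" using assms by (intro mult_right_mono mult_mono) auto
    also have "\<dots> = n ^ 4" by (simp add: power_numeral_reduce)
    finally have "real (3 + 2 * n * Suc (3 * n) * 64) \<le> real (n ^ 4)" by (rule of_nat_mono)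
    then have "log 2 (real (3 + 2 * n * Suc (3 * n) * 64)) \<le> log 2 (real (n ^ 4))"
      by (intro log_mono) (auto intro: add_pos_nonneg)
    also have "\<dots> = 4 * log 2 (real n)" using assms by (simp add: log_nat_power)
    finally show "log 2 (real (3 + 2 * n * Suc (3 * n) * 64)) \<le> 4 * log 2 (real n)" .
    show "0 \<le> log 2 (real (3 + 2 * n * Suc (3 * n) * 64))" by (rule log2_add_nonneg)
  qed (use assms in auto)
  finally show ?thesis by (simp add: mult_ac)
qed

text \<open>The real upper bound excludes \<open>\<infinity>\<close>, where \<open>enn2real\<close>
  would return \<open>0\<close>.\<close>

lemma ennreal_between:
  assumes "ennreal a \<le> t" "t \<le> ennreal b" "0 \<le> b"
  shows "a \<le> enn2real t" "enn2real t \<le> b"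
proof -
  have "t < top" using assms(2) by (simp add: order.strict_trans1)
  then show "a \<le> enn2real t" using assms(1) by (cases t) (auto simp: ennreal_le_iff2)
  show "enn2real t \<le> b" using assms(2,3) by (metis enn2real_ennreal enn2real_mono ennreal_less_top)
qed

theorem theorem4:
  "(\<lambda>n. enn2real (TS_2DFA (L_EQ n))) \<in> \<Theta>(\<lambda>n. real n ^ 2) \<and>
   (\<lambda>n. enn2real (TS_2PFA (L_EQ n))) \<in> \<Theta>(\<lambda>n. real n * log 2 (real n))"
proof (intro conjI bigthetaI')
  show "eventually (\<lambda>n. 1 * norm (real n ^ 2) \<le> norm (enn2real (TS_2DFA (L_EQ n))) \<and>
      norm (enn2real (TS_2DFA (L_EQ n))) \<le> 40 * norm (real n ^ 2)) at_top"
    using eventually_ge_at_top[of 1]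
  proof eventually_elim
    case (elim n)
    \<comment> \<open>For \<open>n \<ge> 1\<close> the factors are at most \<open>5 * n\<close> and
      \<open>8 * n\<close>, whence the constant \<open>40\<close>.\<close>
    have "real (3 * n + 2) * real (4 * n + 4) \<le> (5 * real n) * (8 * real n)"
      using elim by (intro mult_mono) auto
    also have "\<dots> = 40 * real n ^ 2" by (simp add: power2_eq_square)
    finally show ?case
      using ennreal_between[OF TS_2DFA_L_EQ_ge[of n] TS_2DFA_L_EQ_le[of n]] by simp
  qed
next
  show "eventually (\<lambda>n. 1/4 * norm (real n * log 2 (real n)) \<le> norm (enn2real (TS_2PFA (L_EQ n))) \<and>
      norm (enn2real (TS_2PFA (L_EQ n))) \<le> 20 * norm (real n * log 2 (real n))) at_top"
    using eventually_ge_at_top[of 64]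
  proof eventually_elim
    case (elim n)
    have "0 \<le> real n * log 2 (real n)" using elim by simp
    then show ?case
      using ennreal_between[OF TS_2PFA_L_EQ_ge[OF elim] TS_2PFA_L_EQ_le[OF elim]] by simp
  qed
qed auto

end
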